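(* Let $\mu$ be a probability measure on $\mathbb C$ satisfying: (H1) the support of $\mu$ intersects both $\{|z|<1\}$ and $\{|z|>1\}$ and is bounded away from $0$; (H2) there is $t>1$ with $\int|z|^t\,d\mu(z)<\infty$; (H3) $\int\log|z|\,d\mu(z)<0$; (H4) there are $C>0$ and $\rho\in(0,1]$ such that $\sup_{x>0}\mu(\{z: x<|z|<x+h\})\le Ch^\rho$ for all $h>0$. Let $\theta$ be the unique positive number such that $\int|z|^{2\theta}d\mu(z)=1$, and assume $\theta<1$. Let $d_1,\dots,d_N$ be i.i.d. with law $\mu$, $D=\mathrm{diag}(d_1,\dots,d_N)$, $\sigma\in\mathcal S_N$ and $A=D+M_\sigma$. There exist constants $k_0>0$ and $\delta_0>0$ such that for every $\delta<\delta_0$ and for every $t>0$: (1) $$\mathbb P_D[s_{\min}^2(A)\le t]\le C(\delta)L(k_0,\sigma)\,t^\delta+CN\,t^\theta\Big(\log\frac1t\Big)^\theta.$$ (2) This implies the estimate $$\mathbb P_D[s_{\min}^2(A)\le t]\le CN\,t^\alpha$$ with any $\alpha<\min(\theta,\delta)$. (3) If one considers a sequence of permutations $\sigma_N\in\mathcal S_N$ such that $L(k_0,\sigma_N)=o(N^{\delta/\theta})$, and $A=D+M_{\sigma_N}$, then the sequence of distributions of the random variables $(N^{1/\theta}\log N\; s_{\min}^2(A))^{-1}$ is tight, and $$\limsup_{N\to\infty}\mathbb P_D\Big[s_{\min}^2(A)\le\frac{u}{N^{1/\theta}\log N}\Big]\le Cu^\theta\Big(\log\frac1u\Big)^\theta.$$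 (4) In particular, if the permutations $\sigma_N$ are chosen randomly under the uniform measure $\mathbb P_N$ on $\mathcal S_N$, and $A=D+M_{\sigma_N}$, then the sequence of distributions of the random variables $(N^{1/\theta}\log N\; s_{\min}^2(A))^{-1}$ is tight under the product measure $\mathbb P_N\times\mathbb P_D$, and $$\limsup_{N\to\infty}\mathbb P_N\times\mathbb P_D\Big[s_{\min}^2(A)\le\frac{u}{N^{1/\theta}\log N}\Big]\le Cu^\theta\Big(\log\frac1u\Big)^\theta.$$
   Context: $\mathcal S_N$ is the symmetric group; $M_\sigma$ is the $N\times N$ matrix with $M_\sigma(i,j)=1$ if $\sigma(i)=j$ and $0$ otherwise; $s_{\min}$ is the smallest singular value. $\mathbb P_D$ is the law of the i.i.d. diagonal entries. For a permutation $\sigma$ with $K(\sigma)$ cycles of lengths $N_1,\dots,N_{K(\sigma)}$ (fixed points included) and $k>0$, $L(k,\sigma)=\sum_{i=1}^{K(\sigma)}e^{-kN_i}$. $C$ and $C(\delta)$ denote constants, possibly different in each display.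
   Formalization: log(1/t) and log(1/u) are read as max(1, log(1/t)) and max(1, log(1/u)): the printed power is undefined for t>1, and bound (1) fails as t→1- for a single long cycle; δ and α are taken positive. *)

theory Defs
  imports
    "HOL-Probability.Probability"
    "HOL-Combinatorics.Orbits"
    "HOL-Library.Landau_Symbols"
    "Jordan_Normal_Form.Schur_Decomposition"
begin

text \<open>Rows and columns are indexed by \<open>{..<N}\<close>; an element of the symmetric group
  is a function \<open>\<sigma>\<close> with \<open>\<sigma> permutes {..<N}\<close>.\<close>

definition perm_mat :: "nat \<Rightarrow> (nat \<Rightarrow> nat) \<Rightarrow> complex mat" where
  "perm_mat N \<sigma> = Matrix.mat N N (\<lambda>(i, j). if \<sigma> i = j then 1 else 0)"

definition diag_plus_perm :: "nat \<Rightarrow> (nat \<Rightarrow> complex) \<Rightarrow> (nat \<Rightarrow> nat) \<Rightarrow> complex mat" where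
  "diag_plus_perm N d \<sigma> = mat_diag N d + perm_mat N \<sigma>"

definition singular_values :: "complex mat \<Rightarrow> real set" where
  "singular_values A = {s. 0 \<le> s \<and> eigenvalue (mat_adjoint A * A) (complex_of_real (s\<^sup>2))}"

text \<open>For a matrix with at least one column, the set of singular values is finite and nonempty.\<close>

definition s_min :: "complex mat \<Rightarrow> real" where
  "s_min A = Min (singular_values A)"

text \<open>The cycles of a permutation, fixed points included, are its orbits.\<close>

definition cycle_sum :: "real \<Rightarrow> nat \<Rightarrow> (nat \<Rightarrow> nat) \<Rightarrow> real" where
  "cycle_sum k N \<sigma> = (\<Sum>c\<in>orbit \<sigma> ` {..<N}. exp (- k * real (card c)))"

definition measure_support :: "complex measure \<Rightarrow> complex set" where
  "measure_support \<mu> = {z. \<forall>U. open U \<longrightarrow> z \<in> U \<longrightarrow> 0 < emeasure \<mu> U}"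

text \<open>The law of \<open>N\<close> i.i.d. diagonal entries.\<close>

definition diag_law :: "complex measure \<Rightarrow> nat \<Rightarrow> (nat \<Rightarrow> complex) measure" where
  "diag_law \<mu> N = Pi\<^sub>M {..<N} (\<lambda>_. \<mu>)"

definition perm_law :: "nat \<Rightarrow> (nat \<Rightarrow> nat) measure" where
  "perm_law N = uniform_count_measure {\<sigma>. \<sigma> permutes {..<N}}"

text \<open>Convention for the factor \<open>log (1/t)\<close> in upper bounds for probabilities that are asserted
  for all \<open>t > 0\<close>: it is the plain logarithm for \<open>t \<le> 1/e\<close>, and is replaced by 1 for larger
  \<open>t\<close>, where \<open>log (1/t)\<close> degenerates at 1 and \<open>(log (1/t)) ^ \<theta>\<close> is undefined beyond 1.\<close>

definition log_inv :: "real \<Rightarrow> real" where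
  "log_inv t = max 1 (ln (1 / t))"

text \<open>Meaningful for \<open>N \<ge> 2\<close> (for \<open>N = 1\<close> the factor \<open>ln N\<close> vanishes) and \<open>s_min A \<noteq> 0\<close>;
  otherwise \<open>inverse 0 = 0\<close>, so almost sure positivity of \<open>s_min A\<close> has to be stated separately
  wherever this quantity is used as a random variable.\<close>

definition inv_scaled_s_min :: "real \<Rightarrow> nat \<Rightarrow> complex mat \<Rightarrow> real" where
  "inv_scaled_s_min \<theta> N A = inverse (real N powr (1 / \<theta>) * ln (real N) * (s_min A)\<^sup>2)"

end

theory Submission
  imports Defs "Jordan_Normal_Form.Spectral_Radius" "HOL-Real_Asymp.Real_Asymp"
begin

text \<open>Along a cycle \<open>c\<close> of length \<open>n\<close> the equation \<open>A x = y\<close> is the recursion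
\<open>x (\<sigma> i) = y i - d i * x i\<close>. Going once round the cycle gives \<open>(1 - P) * x i\<close>, with
\<open>P\<close> the product of the \<open>- d j\<close> over \<open>c\<close>, as a sum of entries of \<open>y\<close> weighted by products of
consecutive entries of \<open>d\<close>. By Cauchy-Schwarz, \<open>s_min\<^sup>2 \<le> t\<close> forces
\<open>\<bar>1 - P\<bar>\<^sup>2 \<le> t * Z\<close> on some cycle, where \<open>Z\<close> sums \<open>\<Prod>j\<in>J. \<bar>d j\<bar>\<^sup>2\<close> over the \<open>n\<^sup>2\<close> arcs
\<open>J\<close> of \<open>c\<close> of length less than \<open>n\<close> (\<open>small_s_min_imp_small_cycle\<close>). Everything else bounds the
probability of that event for one cycle.

The heavy tail comes from \<open>Z\<close>. Since \<open>E \<bar>d\<bar> powr (2 * \<theta>) = 1\<close> while \<open>q = E \<bar>d\<bar> powr \<theta> < 1\<close> (a strict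
Jensen inequality, as \<open>\<bar>d\<bar>\<close> is not identically 1), the function
\<open>min (y powr (- \<theta> / 2)) (y powr (- \<theta>))\<close> is superharmonic for the multiplicative random walk with
steps \<open>\<bar>d\<bar>\<^sup>2\<close>, and a multiple of it dominates the expected number of times at which the walk is above \<open>y\<close>
(\<open>sum_ptail_le_min\<close>). So this expected number is \<open>O(y powr (- \<theta>))\<close>. Because \<open>\<theta> < 1\<close>, splitting into dyadic
levels turns it into \<open>P (Z \<ge> s) \<le> C * n * s powr (- \<theta>)\<close> for the whole cycle at once: a
heavy-tailed sum is as large as its largest term (\<open>emeasure_sum_prods_ge_le\<close>).

If \<open>\<bar>P\<bar> < 1/2\<close> then \<open>Z \<ge> 1 / (4 * t)\<close>, which costs \<open>C * n * t powr \<theta>\<close>. Otherwise \<open>\<bar>P\<bar> \<ge> 1/2\<close>, an event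
of probability \<open>O(q ^ n)\<close>, and moreover either \<open>\<bar>1 - P\<bar> \<le> t powr (1/4)\<close> or \<open>Z \<ge> t powr (- 1/2)\<close>. Each of the
last two has a probability that is a power of \<open>t\<close>, up to a factor growing with \<open>n\<close>: for the first
by the Hoelder bound on the law of \<open>\<bar>d\<bar>\<close>, for the second by the tail of \<open>Z\<close>. A geometric mean of
the two estimates keeps an exponentially small factor in \<open>n\<close> and a power of \<open>t\<close>
(\<open>prob_small_cycle_le\<close>). Summing over the cycles produces \<open>L(k\<^sub>0, \<sigma>)\<close> from the second case and
\<open>N * t powr \<theta>\<close> from the first, which is the estimate for \<open>s_min\<close> (\<open>prob_s_min_le\<close>), since \<open>log_inv t \<ge> 1\<close>.

The remaining parts evaluate this estimate at \<open>t = u / (N powr (1 / \<theta>) * ln N)\<close>. For a uniform random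
permutation one averages over \<open>\<sigma>\<close>; as \<open>L(k, \<sigma>)\<close> is at most the number of cycles, whose mean
is a harmonic number, the average is \<open>O(log N)\<close>.\<close>

section \<open>Singular values of complex matrices\<close>

lemma mat_adjoint_index:
  assumes "A \<in> carrier_mat n m" "i < m" "j < n"
  shows "mat_adjoint A $$ (i, j) = conjugate (A $$ (j, i))"
  using assms unfolding mat_adjoint_def by (simp add: mat_of_rows_def)

lemma mat_adjoint_carrier: "A \<in> carrier_mat n m \<Longrightarrow> mat_adjoint A \<in> carrier_mat m n"
  unfolding mat_adjoint_def by (auto simp: mat_of_rows_def)

lemma mult_mat_vec_index_sum:
  assumes "A \<in> carrier_mat n m" "v \<in> carrier_vec m" "i < n"
  shows "vec_index (A *\<^sub>v v) i = (\<Sum>j<m. A $$ (i, j) * vec_index v j)"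
  using assms by (simp add: scalar_prod_def atLeast0LessThan)

lemma mat_adjoint_inner_prod:
  fixes A :: "complex mat"
  assumes A: "A \<in> carrier_mat n m" and w: "w \<in> carrier_vec n" and v: "v \<in> carrier_vec m"
  shows "(\<Sum>i<m. vec_index (mat_adjoint A *\<^sub>v w) i * cnj (vec_index v i))
       = (\<Sum>j<n. vec_index w j * cnj (vec_index (A *\<^sub>v v) j))"
proof -
  have "(\<Sum>i<m. vec_index (mat_adjoint A *\<^sub>v w) i * cnj (vec_index v i))
      = (\<Sum>i<m. \<Sum>j<n. cnj (A $$ (j, i)) * vec_index w j * cnj (vec_index v i))"
    by (intro sum.cong refl, subst mult_mat_vec_index_sum[OF mat_adjoint_carrier[OF A] w])
       (auto simp: mat_adjoint_index[OF A] sum_distrib_right)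
  also have "\<dots> = (\<Sum>j<n. \<Sum>i<m. cnj (A $$ (j, i)) * vec_index w j * cnj (vec_index v i))"
    by (rule sum.swap)
  also have "\<dots> = (\<Sum>j<n. vec_index w j * cnj (vec_index (A *\<^sub>v v) j))"
    by (intro sum.cong refl, subst mult_mat_vec_index_sum[OF A v])
       (auto simp: sum_distrib_left mult_ac)
  finally show ?thesis .
qed

text \<open>An eigenvector of \<open>A\<^sup>* A\<close> realises its eigenvalue as the Rayleigh quotient
  \<open>\<bar>A v\<bar>\<^sup>2 / \<bar>v\<bar>\<^sup>2\<close>. Hence all eigenvalues are nonnegative reals, and a small \<open>s_min\<close>
  comes with a vector that \<open>A\<close> nearly annihilates.\<close>

lemma Rayleigh_adjoint_mult:
  fixes A :: "complex mat"
  assumes A: "A \<in> carrier_mat n n" and ev: "eigenvector (mat_adjoint A * A) v k"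
  shows "k * complex_of_real (\<Sum>i<n. (cmod (vec_index v i))\<^sup>2)
       = complex_of_real (\<Sum>i<n. (cmod (vec_index (A *\<^sub>v v) i))\<^sup>2)"
    and "0 < (\<Sum>i<n. (cmod (vec_index v i))\<^sup>2)" and "v \<in> carrier_vec n"
proof -
  have dim: "dim_row (mat_adjoint A * A) = n"
    using mat_adjoint_carrier[OF A] by simp
  show v: "v \<in> carrier_vec n" and "0 < (\<Sum>i<n. (cmod (vec_index v i))\<^sup>2)"
  proof -
    show v: "v \<in> carrier_vec n"
      using ev dim unfolding eigenvector_def by simp
    have "v \<noteq> 0\<^sub>v n"
      using ev dim unfolding eigenvector_def by simp
    then obtain i where "i < n" "vec_index v i \<noteq> 0"
      using v by (metis carrier_vecD eq_vecI index_zero_vec(1) index_zero_vec(2))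
    then show "0 < (\<Sum>i<n. (cmod (vec_index v i))\<^sup>2)"
      by (intro sum_pos2[of _ i]) auto
  qed
  have "(mat_adjoint A * A) *\<^sub>v v = k \<cdot>\<^sub>v v"
    using ev unfolding eigenvector_def by simp
  then have eq: "mat_adjoint A *\<^sub>v (A *\<^sub>v v) = k \<cdot>\<^sub>v v"
    using assoc_mult_mat_vec[OF mat_adjoint_carrier[OF A] A v] by simp
  have "k * complex_of_real (\<Sum>i<n. (cmod (vec_index v i))\<^sup>2)
      = (\<Sum>i<n. vec_index (k \<cdot>\<^sub>v v) i * cnj (vec_index v i))"
    using v by (simp add: sum_distrib_left complex_norm_square mult.assoc del: of_real_power)
  also have "\<dots> = (\<Sum>j<n. vec_index (A *\<^sub>v v) j * cnj (vec_index (A *\<^sub>v v) j))"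
    using mat_adjoint_inner_prod[OF A _ v, of "A *\<^sub>v v"] A v unfolding eq by simp
  also have "\<dots> = complex_of_real (\<Sum>i<n. (cmod (vec_index (A *\<^sub>v v) i))\<^sup>2)"
    by (simp add: complex_norm_square del: of_real_power)
  finally show "k * complex_of_real (\<Sum>i<n. (cmod (vec_index v i))\<^sup>2)
       = complex_of_real (\<Sum>i<n. (cmod (vec_index (A *\<^sub>v v) i))\<^sup>2)" .
qed

lemma singular_values_finite_nonempty:
  fixes A :: "complex mat"
  assumes A: "A \<in> carrier_mat n n" and n: "0 < n"
  shows "finite (singular_values A)" "singular_values A \<noteq> {}"
proof -
  let ?B = "mat_adjoint A * A"
  have B: "?B \<in> carrier_mat n n"
    using mat_adjoint_carrier[OF A] A by simp
  have "finite {k. eigenvalue ?B k}"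
    using card_finite_spectrum(1)[OF B] by (simp add: spectrum_def)
  moreover have "inj_on (\<lambda>s. complex_of_real (s\<^sup>2)) (singular_values A)"
    by (rule inj_onI)
      (simp only: singular_values_def mem_Collect_eq of_real_eq_iff power2_eq_iff_nonneg)
  moreover have "(\<lambda>s. complex_of_real (s\<^sup>2)) ` singular_values A \<subseteq> {k. eigenvalue ?B k}"
    by (auto simp: singular_values_def)
  ultimately show "finite (singular_values A)"
    using finite_imageD finite_subset by blast
  obtain k where k: "eigenvalue ?B k"
    using spectrum_non_empty[OF B n] by (auto simp: spectrum_def)
  then obtain v where v: "eigenvector ?B v k"
    by (auto simp: eigenvalue_def)
  define r where "r = (\<Sum>i<n. (cmod (vec_index (A *\<^sub>v v) i))\<^sup>2) / (\<Sum>i<n. (cmod (vec_index v i))\<^sup>2)"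
  have "k = complex_of_real r"
    using Rayleigh_adjoint_mult(1)[OF A v] Rayleigh_adjoint_mult(2)[OF A v]
    unfolding r_def of_real_divide by (metis less_numeral_extra(3) nonzero_eq_divide_eq of_real_eq_0_iff)
  moreover have "0 \<le> r"
    unfolding r_def by (intro divide_nonneg_nonneg sum_nonneg) auto
  ultimately have "sqrt r \<in> singular_values A"
    using k by (simp add: singular_values_def del: of_real_power)
  then show "singular_values A \<noteq> {}" by blast
qed

lemma s_min_in_singular_values:
  "A \<in> carrier_mat n n \<Longrightarrow> 0 < n \<Longrightarrow> s_min A \<in> singular_values A"
  using singular_values_finite_nonempty unfolding s_min_def by (meson Min_in)

lemma s_min_nonneg: "A \<in> carrier_mat n n \<Longrightarrow> 0 < n \<Longrightarrow> 0 \<le> s_min A"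
  using s_min_in_singular_values[of A n] by (simp add: singular_values_def)

lemma s_min_vector:
  fixes A :: "complex mat"
  assumes A: "A \<in> carrier_mat n n" and n: "0 < n"
  obtains v where "v \<in> carrier_vec n" "0 < (\<Sum>i<n. (cmod (vec_index v i))\<^sup>2)"
    "(\<Sum>i<n. (cmod (vec_index (A *\<^sub>v v) i))\<^sup>2) = (s_min A)\<^sup>2 * (\<Sum>i<n. (cmod (vec_index v i))\<^sup>2)"
proof -
  obtain v where v: "eigenvector (mat_adjoint A * A) v (complex_of_real ((s_min A)\<^sup>2))"
    using s_min_in_singular_values[OF A n] by (auto simp: singular_values_def eigenvalue_def)
  have "(\<Sum>i<n. (cmod (vec_index (A *\<^sub>v v) i))\<^sup>2) = (s_min A)\<^sup>2 * (\<Sum>i<n. (cmod (vec_index v i))\<^sup>2)"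
    using Rayleigh_adjoint_mult(1)[OF A v] unfolding of_real_mult[symmetric] of_real_eq_iff by simp
  then show thesis
    using that Rayleigh_adjoint_mult(2,3)[OF A v] by blast
qed

text \<open>Measurability of \<open>s_min\<close> reduces to this description by countably many determinants. The
  characteristic polynomial of \<open>A\<^sup>* A\<close>, evaluated at \<open>s\<^sup>2\<close>, is continuous in \<open>s\<close>; so by compactness it vanishes somewhere on
  \<open>[0, t]\<close> exactly when its modulus has infimum 0 over the rational points.\<close>

lemma s_min_le_iff:
  fixes A :: "complex mat"
  assumes A: "A \<in> carrier_mat n n" and n: "0 < n" and t: "0 \<le> t"
  shows "s_min A \<le> t \<longleftrightarrow> (INF s\<in>{0..t} \<inter> \<rat>. cmod (poly (char_poly (mat_adjoint A * A)) (complex_of_real (s\<^sup>2)))) \<le> 0"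
proof -
  let ?B = "mat_adjoint A * A"
  define f where "f s = cmod (poly (char_poly ?B) (complex_of_real (s\<^sup>2)))" for s :: real
  have B: "?B \<in> carrier_mat n n"
    using mat_adjoint_carrier[OF A] A by simp
  have cont: "continuous_on {0..t} f"
    unfolding f_def by (intro continuous_intros)
  have bdd: "bdd_below (f ` ({0..t} \<inter> \<rat>))"
    by (rule bdd_belowI[of _ 0]) (auto simp: f_def)
  have ne: "{0..t} \<inter> \<rat> \<noteq> {}"
    using t by (auto intro!: exI[of _ 0])
  have sv: "s \<in> singular_values A \<longleftrightarrow> 0 \<le> s \<and> f s = 0" for s
    by (simp add: singular_values_def f_def eigenvalue_root_char_poly[OF B])
  have "s_min A \<le> t \<longleftrightarrow> (\<exists>s\<in>{0..t}. f s = 0)"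
    using singular_values_finite_nonempty[OF A n] sv unfolding s_min_def
    by (subst Min_le_iff) (auto)
  also have "\<dots> \<longleftrightarrow> (INF s\<in>{0..t} \<inter> \<rat>. f s) \<le> 0"
  proof
    assume "\<exists>s\<in>{0..t}. f s = 0"
    then obtain s where s: "s \<in> {0..t}" "f s = 0" by blast
    show "(INF s\<in>{0..t} \<inter> \<rat>. f s) \<le> 0"
    proof (rule field_le_epsilon)
      fix e :: real assume e: "0 < e"
      have "\<exists>u\<in>{0..t} \<inter> \<rat>. f u < e"
      proof (cases "t = 0")
        case True
        then show ?thesis using s e by (intro bexI[of _ 0]) auto
      next
        case False
        obtain d where d: "0 < d" "\<And>u. u \<in> {0..t} \<Longrightarrow> dist u s < d \<Longrightarrow> dist (f u) (f s) < e"
          using cont s(1) e unfolding continuous_on_iff by meson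
        have "max 0 (s - d) < min t (s + d)"
          using False t s(1) d(1) by auto
        then obtain u where "u \<in> \<rat>" "max 0 (s - d) < u" "u < min t (s + d)"
          using Rats_dense_in_real by blast
        then show ?thesis
          using d(2)[of u] s(2) by (intro bexI[of _ u]) (auto simp: dist_real_def f_def)
      qed
      then obtain u where u: "u \<in> {0..t} \<inter> \<rat>" "f u < e" by blast
      have "(INF s\<in>{0..t} \<inter> \<rat>. f s) \<le> f u"
        using u(1) bdd by (intro cINF_lower)
      then show "(INF s\<in>{0..t} \<inter> \<rat>. f s) \<le> 0 + e" using u(2) by simp
    qed
  next
    assume le: "(INF s\<in>{0..t} \<inter> \<rat>. f s) \<le> 0"
    obtain s where s: "s \<in> {0..t}" "\<And>u. u \<in> {0..t} \<Longrightarrow> f s \<le> f u"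
      using continuous_attains_inf[OF compact_Icc _ cont] t by auto
    have "f s \<le> (INF s\<in>{0..t} \<inter> \<rat>. f s)"
      using s ne by (intro cINF_greatest) auto
    moreover have "0 \<le> f s" by (simp add: f_def)
    ultimately have "f s = 0" using le by linarith
    then show "\<exists>s\<in>{0..t}. f s = 0" using s(1) by blast
  qed
  finally show ?thesis unfolding f_def .
qed

lemma measurable_det:
  assumes car: "\<And>\<omega>. M' \<omega> \<in> carrier_mat n n"
    and meas: "\<And>i j. i < n \<Longrightarrow> j < n \<Longrightarrow> (\<lambda>\<omega>. M' \<omega> $$ (i, j)) \<in> borel_measurable M"
  shows "(\<lambda>\<omega>. det (M' \<omega>) :: complex) \<in> borel_measurable M"
proof -
  have "(\<lambda>\<omega>. det (M' \<omega>)) = (\<lambda>\<omega>. \<Sum>p | p permutes {0..<n}. signof p * (\<Prod>i=0..<n. M' \<omega> $$ (i, p i)))"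
    by (intro ext det_def'[OF car])
  also have "\<dots> \<in> borel_measurable M"
  proof (intro borel_measurable_sum borel_measurable_times borel_measurable_const borel_measurable_prod)
    fix p i assume "p \<in> {p. p permutes {0..<n}}" "i \<in> {0..<n}"
    then have "i < n" "p i < n" using permutes_in_image[of p "{0..<n}" i] by auto
    then show "(\<lambda>\<omega>. M' \<omega> $$ (i, p i)) \<in> borel_measurable M" by (rule meas)
  qed
  finally show ?thesis .
qed

lemma measurable_s_min:
  assumes car: "\<And>\<omega>. A \<omega> \<in> carrier_mat n n" and n: "0 < n"
    and meas: "\<And>i j. i < n \<Longrightarrow> j < n \<Longrightarrow> (\<lambda>\<omega>. A \<omega> $$ (i, j)) \<in> borel_measurable M"
  shows "(\<lambda>\<omega>. s_min (A \<omega>)) \<in> borel_measurable M"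
proof (rule borel_measurable_iff_le[THEN iffD2], rule allI)
  fix t :: real
  let ?f = "\<lambda>\<omega> s. cmod (poly (char_poly (mat_adjoint (A \<omega>) * A \<omega>)) (complex_of_real (s\<^sup>2)))"
  show "{\<omega> \<in> space M. s_min (A \<omega>) \<le> t} \<in> sets M"
  proof (cases "0 \<le> t")
    case False
    then have "{\<omega> \<in> space M. s_min (A \<omega>) \<le> t} = {}"
      using order_trans[OF s_min_nonneg[OF car n]] by auto
    then show ?thesis by (metis sets.empty_sets)
  next
    case True
    have B: "mat_adjoint (A \<omega>) * A \<omega> \<in> carrier_mat n n" for \<omega>
      using mat_adjoint_carrier[OF car[of \<omega>]] car[of \<omega>] by simp
    have Bm: "(\<lambda>\<omega>. (mat_adjoint (A \<omega>) * A \<omega>) $$ (i, j)) \<in> borel_measurable M" if ij: "i < n" "j < n" for i j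
    proof -
      have "(mat_adjoint (A \<omega>) * A \<omega>) $$ (i, j) = (\<Sum>l<n. cnj (A \<omega> $$ (l, i)) * A \<omega> $$ (l, j))" for \<omega>
        using ij car[of \<omega>] mat_adjoint_carrier[OF car[of \<omega>]]
        by (simp add: scalar_prod_def atLeast0LessThan mat_adjoint_index[OF car])
      moreover have "(\<lambda>\<omega>. \<Sum>l<n. cnj (A \<omega> $$ (l, i)) * A \<omega> $$ (l, j)) \<in> borel_measurable M"
        using ij meas
        by (intro borel_measurable_sum borel_measurable_times
            measurable_compose[OF _ borel_measurable_continuous_onI[of cnj]] continuous_intros) auto
      ultimately show ?thesis by simp
    qed
    have fm: "(\<lambda>\<omega>. ?f \<omega> s) \<in> borel_measurable M" for s
    proof -
      have "(\<lambda>\<omega>. det (- (char_matrix (mat_adjoint (A \<omega>) * A \<omega>) (complex_of_real (s\<^sup>2))))) \<in> borel_measurable M"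
      proof (rule measurable_det[where n = n])
        fix i j assume ij: "i < n" "j < n"
        have "(- char_matrix (mat_adjoint (A \<omega>) * A \<omega>) (complex_of_real (s\<^sup>2))) $$ (i, j)
            = - ((mat_adjoint (A \<omega>) * A \<omega>) $$ (i, j)) + (if i = j then complex_of_real (s\<^sup>2) else 0)" for \<omega>
          using ij B[of \<omega>] car[of \<omega>] mat_adjoint_carrier[OF car[of \<omega>]] unfolding char_matrix_def by auto
        then show "(\<lambda>\<omega>. (- char_matrix (mat_adjoint (A \<omega>) * A \<omega>) (complex_of_real (s\<^sup>2))) $$ (i, j)) \<in> borel_measurable M"
          using Bm[OF ij] by simp
      qed (use B in auto)
      then show ?thesis
        unfolding char_poly_matrix[OF B] by simp
    qed
    have "(\<lambda>\<omega>. INF s\<in>{0..t} \<inter> \<rat>. ?f \<omega> s) \<in> borel_measurable M"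
      using fm by (intro borel_measurable_cINF)
        (auto intro: countable_subset[OF _ countable_rat] bdd_belowI[of _ 0])
    then have "{\<omega> \<in> space M. (INF s\<in>{0..t} \<inter> \<rat>. ?f \<omega> s) \<le> 0} \<in> sets M"
      by measurable
    then show ?thesis
      unfolding s_min_le_iff[OF car n True] .
  qed
qed

section \<open>Cycles of a permutation and near-kernel vectors of \<open>D + M\<^sub>\<sigma>\<close>\<close>

lemma diag_plus_perm_carrier: "diag_plus_perm N d \<sigma> \<in> carrier_mat N N"
  unfolding diag_plus_perm_def perm_mat_def mat_diag_def by auto

lemma diag_plus_perm_index:
  "i < N \<Longrightarrow> j < N \<Longrightarrow>
    diag_plus_perm N d \<sigma> $$ (i, j) = (if i = j then d i else 0) + (if \<sigma> i = j then 1 else 0)"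
  unfolding diag_plus_perm_def perm_mat_def mat_diag_def by auto

lemma diag_plus_perm_mult_vec_index:
  assumes "\<sigma> permutes {..<N}" "v \<in> carrier_vec N" "i < N"
  shows "vec_index (diag_plus_perm N d \<sigma> *\<^sub>v v) i = d i * vec_index v i + vec_index v (\<sigma> i)"
proof -
  have "\<sigma> i < N" using assms(1,3) permutes_in_image[of \<sigma> "{..<N}" i] by simp
  have "vec_index (diag_plus_perm N d \<sigma> *\<^sub>v v) i
      = (\<Sum>j<N. diag_plus_perm N d \<sigma> $$ (i, j) * vec_index v j)"
    by (rule mult_mat_vec_index_sum[OF diag_plus_perm_carrier assms(2,3)])
  also have "\<dots> = (\<Sum>j<N. (if j = i then d i * vec_index v i else 0)
      + (if j = \<sigma> i then vec_index v (\<sigma> i) else 0))"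
    using assms(3) by (intro sum.cong refl) (auto simp: diag_plus_perm_index distrib_right)
  also have "\<dots> = d i * vec_index v i + vec_index v (\<sigma> i)"
    using assms(3) \<open>\<sigma> i < N\<close> by (simp only: sum.distrib sum.delta finite_lessThan lessThan_iff if_True)
  finally show ?thesis .
qed

lemma linear_recurrence_unroll:
  fixes c x y :: "nat \<Rightarrow> 'a :: comm_ring_1"
  assumes "\<And>k. x (Suc k) = y k + c k * x k"
  shows "x n = (\<Prod>k<n. c k) * x 0 + (\<Sum>j<n. (\<Prod>k\<in>{Suc j..<n}. c k) * y j)"
proof (induction n)
  case (Suc n)
  have *: "{Suc j..<Suc n} = insert n {Suc j..<n}" if "j < n" for j
    using that by auto
  have S: "(\<Sum>j<Suc n. (\<Prod>k\<in>{Suc j..<Suc n}. c k) * y j) = c n * (\<Sum>j<n. (\<Prod>k\<in>{Suc j..<n}. c k) * y j) + y n"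
  proof -
    have "(\<Prod>k\<in>{Suc j..<Suc n}. c k) * y j = c n * ((\<Prod>k\<in>{Suc j..<n}. c k) * y j)" if "j < n" for j
      unfolding *[OF that] by (simp add: mult.assoc)
    then have "(\<Sum>j<n. (\<Prod>k\<in>{Suc j..<Suc n}. c k) * y j) = (\<Sum>j<n. c n * ((\<Prod>k\<in>{Suc j..<n}. c k) * y j))"
      by (intro sum.cong refl) simp
    then show ?thesis by (simp only: sum.lessThan_Suc sum_distrib_left) simp
  qed
  have "x (Suc n) = y n + c n * ((\<Prod>k<n. c k) * x 0 + (\<Sum>j<n. (\<Prod>k\<in>{Suc j..<n}. c k) * y j))"
    using assms[of n] Suc.IH by argo
  also have "\<dots> = (\<Prod>k<Suc n. c k) * x 0 + (\<Sum>j<Suc n. (\<Prod>k\<in>{Suc j..<Suc n}. c k) * y j)"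
    unfolding S prod.lessThan_Suc by (simp only: algebra_simps)
  finally show ?case .
qed simp

lemma Cauchy_Schwarz_complex_sum:
  fixes w y :: "'b \<Rightarrow> complex"
  shows "(cmod (\<Sum>j\<in>J. w j * y j))\<^sup>2 \<le> (\<Sum>j\<in>J. (cmod (w j))\<^sup>2) * (\<Sum>j\<in>J. (cmod (y j))\<^sup>2)"
proof -
  have "cmod (\<Sum>j\<in>J. w j * y j) \<le> (\<Sum>j\<in>J. cmod (w j) * cmod (y j))"
    by (rule sum_norm_le) (simp add: norm_mult)
  then have "(cmod (\<Sum>j\<in>J. w j * y j))\<^sup>2 \<le> (\<Sum>j\<in>J. cmod (w j) * cmod (y j))\<^sup>2"
    by (intro power_mono) auto
  also have "\<dots> \<le> (\<Sum>j\<in>J. (cmod (w j))\<^sup>2) * (\<Sum>j\<in>J. (cmod (y j))\<^sup>2)"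
    by (rule Cauchy_Schwarz_ineq_sum)
  finally show ?thesis .
qed

lemma funpow_permutes_in: "\<sigma> permutes S \<Longrightarrow> i \<in> S \<Longrightarrow> (\<sigma> ^^ k) i \<in> S"
  by (induction k) (auto simp: permutes_in_image)

lemma permutes_finite_permutation: "\<sigma> permutes S \<Longrightarrow> finite S \<Longrightarrow> permutation \<sigma>"
  using permutation_permutes by blast

lemma orbit_subset_permutes:
  assumes "\<sigma> permutes S" "i \<in> S" shows "orbit \<sigma> i \<subseteq> S"
proof
  fix x assume "x \<in> orbit \<sigma> i"
  then obtain n where "x = (\<sigma> ^^ n) i" unfolding orbit_altdef by blast
  then show "x \<in> S" using funpow_permutes_in[OF assms] by simp
qed

lemma orbit_enumerate:
  assumes \<sigma>: "\<sigma> permutes S" "finite S" and i: "i \<in> S"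
  shows "bij_betw (\<lambda>k. (\<sigma> ^^ k) i) {..<card (orbit \<sigma> i)} (orbit \<sigma> i)"
    and "(\<sigma> ^^ card (orbit \<sigma> i)) i = i"
proof -
  have self: "i \<in> orbit \<sigma> i"
    using permutation_self_in_orbit[OF permutes_finite_permutation[OF \<sigma>]] .
  define n where "n = funpow_dist1 \<sigma> i i"
  have n: "0 < n" "(\<sigma> ^^ n) i = i"
    using funpow_dist1_prop[OF self] by (auto simp: n_def)
  have inj: "inj_on (\<lambda>k. (\<sigma> ^^ k) i) {..<n}"
    using inj_on_funpow_dist1[OF self] by (simp add: n_def atLeast0LessThan)
  have im: "(\<lambda>k. (\<sigma> ^^ k) i) ` {..<n} = orbit \<sigma> i"
    using orbit_altdef_bounded[OF n(2,1)] by auto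
  have card: "card (orbit \<sigma> i) = n"
    using card_image[OF inj] im by simp
  show "bij_betw (\<lambda>k. (\<sigma> ^^ k) i) {..<card (orbit \<sigma> i)} (orbit \<sigma> i)"
    using inj im card by (simp add: bij_betw_def)
  show "(\<sigma> ^^ card (orbit \<sigma> i)) i = i"
    using n card by simp
qed

lemma orbit_eq_orbit:
  assumes "permutation \<sigma>" "j \<in> orbit \<sigma> i" shows "orbit \<sigma> j = orbit \<sigma> i"
proof -
  have "i \<in> orbit \<sigma> i" using assms(1) by (rule permutation_self_in_orbit)
  then have "i \<in> orbit \<sigma> j" using assms(2) by (rule orbit_swap)
  then show ?thesis
    using assms(2) by (intro equalityI subsetI) (erule (1) orbit_trans)+
qed

text \<open>The last \<open>k\<close> points met on the way from \<open>i\<close> once round its cycle. As \<open>i\<close> runs through the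
  cycle, these are all the arcs of \<open>k\<close> consecutive points.\<close>

definition cycle_tail :: "(nat \<Rightarrow> nat) \<Rightarrow> nat \<Rightarrow> nat \<Rightarrow> nat set" where
  "cycle_tail \<sigma> i k = (\<lambda>l. (\<sigma> ^^ l) i) ` {card (orbit \<sigma> i) - k..<card (orbit \<sigma> i)}"

definition cycle_energy :: "(nat \<Rightarrow> complex) \<Rightarrow> (nat \<Rightarrow> nat) \<Rightarrow> nat set \<Rightarrow> real" where
  "cycle_energy d \<sigma> c = (\<Sum>i\<in>c. \<Sum>k<card c. \<Prod>j\<in>cycle_tail \<sigma> i k. (cmod (d j))\<^sup>2)"

lemma cycle_energy_nonneg: "0 \<le> cycle_energy d \<sigma> c"
  unfolding cycle_energy_def by (intro sum_nonneg prod_nonneg) auto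

lemma cycle_tail_props:
  assumes \<sigma>: "\<sigma> permutes {..<N}" and i: "i < N" and k: "k \<le> card (orbit \<sigma> i)"
  shows "cycle_tail \<sigma> i k \<subseteq> {..<N}" "card (cycle_tail \<sigma> i k) = k"
proof -
  have bij: "bij_betw (\<lambda>k. (\<sigma> ^^ k) i) {..<card (orbit \<sigma> i)} (orbit \<sigma> i)"
    using orbit_enumerate[OF \<sigma>] i by simp
  show "cycle_tail \<sigma> i k \<subseteq> {..<N}"
    using funpow_permutes_in[OF \<sigma>] i by (auto simp: cycle_tail_def)
  have "inj_on (\<lambda>l. (\<sigma> ^^ l) i) {card (orbit \<sigma> i) - k..<card (orbit \<sigma> i)}"
    using bij by (auto simp: bij_betw_def intro: inj_on_subset)
  then show "card (cycle_tail \<sigma> i k) = k"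
    using k by (simp add: cycle_tail_def card_image)
qed

text \<open>Solving \<open>x (\<sigma> i) = y i - d i * x i\<close> once round the cycle returns to \<open>x i\<close>, multiplied by the
  product of all \<open>- d j\<close>. The weights of the entries of \<open>y\<close> are products over the tails of the
  cycle, so Cauchy-Schwarz produces \<open>cycle_energy\<close>.\<close>

lemma cycle_lower_bound:
  fixes d :: "nat \<Rightarrow> complex"
  assumes \<sigma>: "\<sigma> permutes {..<N}" and c: "c \<in> orbit \<sigma> ` {..<N}" and v: "v \<in> carrier_vec N"
  defines "y \<equiv> diag_plus_perm N d \<sigma> *\<^sub>v v"
  shows "(cmod (1 - (\<Prod>j\<in>c. - d j)))\<^sup>2 * (\<Sum>i\<in>c. (cmod (vec_index v i))\<^sup>2)
    \<le> cycle_energy d \<sigma> c * (\<Sum>i\<in>c. (cmod (vec_index y i))\<^sup>2)"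
proof -
  let ?P = "\<Prod>j\<in>c. - d j"
  have perm: "permutation \<sigma>" using permutes_finite_permutation[OF \<sigma>] by simp
  have each: "(cmod (1 - ?P))\<^sup>2 * (cmod (vec_index v i))\<^sup>2
      \<le> (\<Sum>k<card c. \<Prod>j\<in>cycle_tail \<sigma> i k. (cmod (d j))\<^sup>2) * (\<Sum>i\<in>c. (cmod (vec_index y i))\<^sup>2)"
    if ic: "i \<in> c" for i
  proof -
    have ci: "c = orbit \<sigma> i" and i: "i < N"
      using c ic orbit_eq_orbit[OF perm] orbit_subset_permutes[OF \<sigma>] by (blast, fastforce)
    define n where "n = card c"
    define p where "p k = (\<sigma> ^^ k) i" for k
    have bij: "bij_betw p {..<n} c" and pn: "p n = i"
      using orbit_enumerate[OF \<sigma>] i unfolding n_def p_def ci by auto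
    have pN: "p k < N" for k
      using funpow_permutes_in[OF \<sigma>] i unfolding p_def by auto
    have rec: "vec_index v (p (Suc k)) = vec_index y (p k) + (- d (p k)) * vec_index v (p k)" for k
      using diag_plus_perm_mult_vec_index[OF \<sigma> v pN, of d k] unfolding y_def p_def by simp
    have "vec_index v (p n) = (\<Prod>k<n. - d (p k)) * vec_index v (p 0)
        + (\<Sum>j<n. (\<Prod>k\<in>{Suc j..<n}. - d (p k)) * vec_index y (p j))"
      by (rule linear_recurrence_unroll[of "\<lambda>k. vec_index v (p k)"]) (rule rec)
    moreover have "(\<Prod>k<n. - d (p k)) = ?P"
      by (rule prod.reindex_bij_betw[OF bij])
    moreover have "p 0 = i" by (simp add: p_def)
    ultimately have "(1 - ?P) * vec_index v i = (\<Sum>j<n. (\<Prod>k\<in>{Suc j..<n}. - d (p k)) * vec_index y (p j))"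
      using pn by (simp add: algebra_simps)
    then have "(cmod (1 - ?P))\<^sup>2 * (cmod (vec_index v i))\<^sup>2
        = (cmod (\<Sum>j<n. (\<Prod>k\<in>{Suc j..<n}. - d (p k)) * vec_index y (p j)))\<^sup>2"
      by (metis norm_mult power_mult_distrib)
    also have "\<dots> \<le> (\<Sum>j<n. (cmod (\<Prod>k\<in>{Suc j..<n}. - d (p k)))\<^sup>2) * (\<Sum>j<n. (cmod (vec_index y (p j)))\<^sup>2)"
      by (rule Cauchy_Schwarz_complex_sum)
    also have "(\<Sum>j<n. (cmod (vec_index y (p j)))\<^sup>2) = (\<Sum>i\<in>c. (cmod (vec_index y i))\<^sup>2)"
      by (rule sum.reindex_bij_betw[OF bij])
    also have "(\<Sum>j<n. (cmod (\<Prod>k\<in>{Suc j..<n}. - d (p k)))\<^sup>2)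
        = (\<Sum>k<n. (cmod (\<Prod>l\<in>{n - k..<n}. - d (p l)))\<^sup>2)"
      by (rule sum.reindex_bij_witness[of _ "\<lambda>k. n - Suc k" "\<lambda>k. n - Suc k"])
         (auto simp: Suc_diff_Suc)
    also have "\<dots> = (\<Sum>k<n. \<Prod>j\<in>cycle_tail \<sigma> i k. (cmod (d j))\<^sup>2)"
    proof (intro sum.cong refl)
      fix k assume "k \<in> {..<n}"
      have "inj_on p {n - k..<n}"
        using bij by (auto simp: bij_betw_def intro: inj_on_subset)
      then have "(\<Prod>j\<in>p ` {n - k..<n}. (cmod (d j))\<^sup>2) = (\<Prod>l\<in>{n - k..<n}. (cmod (d (p l)))\<^sup>2)"
        by (rule prod.reindex[unfolded o_def])
      also have "\<dots> = (cmod (\<Prod>l\<in>{n - k..<n}. - d (p l)))\<^sup>2"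
        by (simp only: prod_norm[symmetric] prod_power_distrib norm_minus_cancel)
      also have "p ` {n - k..<n} = cycle_tail \<sigma> i k"
        by (auto simp: cycle_tail_def p_def n_def ci)
      finally show "(cmod (\<Prod>l\<in>{n - k..<n}. - d (p l)))\<^sup>2 = (\<Prod>j\<in>cycle_tail \<sigma> i k. (cmod (d j))\<^sup>2)"
        by (rule sym)
    qed
    finally show ?thesis unfolding n_def .
  qed
  have "(cmod (1 - ?P))\<^sup>2 * (\<Sum>i\<in>c. (cmod (vec_index v i))\<^sup>2)
      = (\<Sum>i\<in>c. (cmod (1 - ?P))\<^sup>2 * (cmod (vec_index v i))\<^sup>2)"
    by (rule sum_distrib_left)
  also have "\<dots> \<le> (\<Sum>i\<in>c. (\<Sum>k<card c. \<Prod>j\<in>cycle_tail \<sigma> i k. (cmod (d j))\<^sup>2) * (\<Sum>i\<in>c. (cmod (vec_index y i))\<^sup>2))"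
    by (rule sum_mono) (rule each)
  also have "\<dots> = cycle_energy d \<sigma> c * (\<Sum>i\<in>c. (cmod (vec_index y i))\<^sup>2)"
    unfolding cycle_energy_def by (rule sum_distrib_right[symmetric])
  finally show ?thesis .
qed

text \<open>The squared norms of \<open>v\<close> and \<open>A v\<close> split over the cycles, so the inequality
  \<open>\<bar>A v\<bar>\<^sup>2 \<le> t * \<bar>v\<bar>\<^sup>2\<close> must hold on one cycle where \<open>v\<close> does not vanish.\<close>

lemma small_s_min_imp_small_cycle:
  assumes \<sigma>: "\<sigma> permutes {..<N}" and N: "0 < N"
    and le: "(s_min (diag_plus_perm N d \<sigma>))\<^sup>2 \<le> t"
  shows "\<exists>c\<in>orbit \<sigma> ` {..<N}. (cmod (1 - (\<Prod>j\<in>c. - d j)))\<^sup>2 \<le> t * cycle_energy d \<sigma> c"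
proof (rule ccontr)
  let ?A = "diag_plus_perm N d \<sigma>" and ?O = "orbit \<sigma> ` {..<N}"
  assume "\<not> ?thesis"
  then have big: "t * cycle_energy d \<sigma> c < (cmod (1 - (\<Prod>j\<in>c. - d j)))\<^sup>2" if "c \<in> ?O" for c
    using that by force
  have t: "0 \<le> t" using le zero_le_power2 order_trans by blast
  obtain v where v: "v \<in> carrier_vec N" "0 < (\<Sum>i<N. (cmod (vec_index v i))\<^sup>2)"
    "(\<Sum>i<N. (cmod (vec_index (?A *\<^sub>v v) i))\<^sup>2) = (s_min ?A)\<^sup>2 * (\<Sum>i<N. (cmod (vec_index v i))\<^sup>2)"
    using s_min_vector[OF diag_plus_perm_carrier N] by metis
  let ?x = "\<lambda>c. \<Sum>i\<in>c. (cmod (vec_index v i))\<^sup>2" and ?y = "\<lambda>c. \<Sum>i\<in>c. (cmod (vec_index (?A *\<^sub>v v) i))\<^sup>2"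
  have perm: "permutation \<sigma>" using permutes_finite_permutation[OF \<sigma>] by simp
  have U: "\<Union>?O = {..<N}"
    using orbit_subset_permutes[OF \<sigma>] permutation_self_in_orbit[OF perm] by blast
  have disj: "c \<inter> c' = {}" if "c \<in> ?O" "c' \<in> ?O" "c \<noteq> c'" for c c'
    using that orbit_eq_orbit[OF perm] by blast
  have fin: "finite c" if "c \<in> ?O" for c
    using that U by (metis Union_upper finite_lessThan finite_subset)
  have split: "(\<Sum>i<N. f i) = (\<Sum>c\<in>?O. \<Sum>i\<in>c. f i)" for f :: "nat \<Rightarrow> real"
  proof -
    have "(\<Sum>i<N. f i) = (\<Sum>i\<in>\<Union>?O. f i)" by (simp only: U)
    also have "\<dots> = (\<Sum>c\<in>?O. \<Sum>i\<in>c. f i)" using fin disj by (subst sum.Union_disjoint) auto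
    finally show ?thesis .
  qed
  have gt: "t * ?x c < ?y c" if c: "c \<in> ?O" and x: "0 < ?x c" for c
  proof -
    have "t * cycle_energy d \<sigma> c * ?x c < (cmod (1 - (\<Prod>j\<in>c. - d j)))\<^sup>2 * ?x c"
      using big[OF c] x by simp
    also have "\<dots> \<le> cycle_energy d \<sigma> c * ?y c"
      using cycle_lower_bound[OF \<sigma> c v(1)] by simp
    finally have "cycle_energy d \<sigma> c * (t * ?x c) < cycle_energy d \<sigma> c * ?y c"
      by (simp add: mult_ac)
    then show ?thesis
      using cycle_energy_nonneg mult_less_cancel_left_disj by (smt (verit))
  qed
  have ge: "t * ?x c \<le> ?y c" if c: "c \<in> ?O" for c
  proof (cases "0 < ?x c")
    case False
    moreover have "0 \<le> ?x c" "0 \<le> ?y c" by (auto intro: sum_nonneg)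
    ultimately show ?thesis by (simp add: not_less)
  qed (use gt[OF c] in simp)
  have "\<exists>c\<in>?O. 0 < ?x c"
  proof (rule ccontr)
    assume "\<not> ?thesis"
    then have "?x c \<le> 0" if "c \<in> ?O" for c using that not_less by blast
    then have "(\<Sum>c\<in>?O. ?x c) \<le> 0" by (rule sum_nonpos)
    then show False using v(2) split by simp
  qed
  then have "(\<Sum>c\<in>?O. t * ?x c) < (\<Sum>c\<in>?O. ?y c)"
    using gt ge by (intro sum_strict_mono_ex1) auto
  then have "t * (\<Sum>i<N. (cmod (vec_index v i))\<^sup>2) < (\<Sum>i<N. (cmod (vec_index (?A *\<^sub>v v) i))\<^sup>2)"
    unfolding split sum_distrib_left .
  then have "t * (\<Sum>i<N. (cmod (vec_index v i))\<^sup>2) < (s_min ?A)\<^sup>2 * (\<Sum>i<N. (cmod (vec_index v i))\<^sup>2)"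
    unfolding v(3) .
  moreover have "(s_min ?A)\<^sup>2 * (\<Sum>i<N. (cmod (vec_index v i))\<^sup>2) \<le> t * (\<Sum>i<N. (cmod (vec_index v i))\<^sup>2)"
    using le v(2) by (intro mult_right_mono) auto
  ultimately show False by linarith
qed

lemma sum_card_orbits:
  assumes \<sigma>: "\<sigma> permutes {..<N}"
  shows "(\<Sum>c\<in>orbit \<sigma> ` {..<N}. card c) = N"
proof -
  let ?O = "orbit \<sigma> ` {..<N}"
  have perm: "permutation \<sigma>" using permutes_finite_permutation[OF \<sigma>] by simp
  have U: "\<Union>?O = {..<N}"
    using orbit_subset_permutes[OF \<sigma>] permutation_self_in_orbit[OF perm] by blast
  have disj: "c \<inter> c' = {}" if "c \<in> ?O" "c' \<in> ?O" "c \<noteq> c'" for c c'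
    using that orbit_eq_orbit[OF perm] by blast
  have fin: "finite c" if "c \<in> ?O" for c
    using that U by (metis Union_upper finite_lessThan finite_subset)
  have "(\<Sum>c\<in>?O. card c) = card (\<Union>?O)"
    using fin disj by (intro card_Union_disjoint[symmetric]) (auto simp: pairwise_def disjnt_def)
  also have "\<dots> = N" by (simp only: U card_lessThan)
  finally show ?thesis .
qed

lemma cycle_sum_le_card:
  assumes "0 \<le> k" shows "cycle_sum k N \<sigma> \<le> real (card (orbit \<sigma> ` {..<N}))"
proof -
  have "cycle_sum k N \<sigma> \<le> (\<Sum>c\<in>orbit \<sigma> ` {..<N}. 1)"
    unfolding cycle_sum_def using assms by (intro sum_mono) auto
  then show ?thesis by simp
qed

lemma cycle_sum_nonneg: "0 \<le> cycle_sum k N \<sigma>"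
  unfolding cycle_sum_def by (intro sum_nonneg) auto

text \<open>Composing with the transposition inserts the new point \<open>a\<close> into the cycle of \<open>b\<close>, so no cycle is
  created: every cycle of the new permutation meets \<open>S\<close>, and points of \<open>S\<close> that shared a cycle
  still do.\<close>

lemma card_orbits_transpose_le:
  assumes p: "p permutes S" and S: "finite S" "a \<notin> S" and b: "b \<in> S"
  shows "card (orbit (Transposition.transpose a b \<circ> p) ` insert a S) \<le> card (orbit p ` S)"
proof -
  let ?q = "Transposition.transpose a b \<circ> p"
  have pa: "p a = a" using p S(2) by (simp add: permutes_def)
  have q: "?q permutes insert a S"
    by (rule permutes_compose[OF permutes_imp_permutes_insert[OF p] permutes_swap_id]) (use b in auto)
  have permq: "permutation ?q" using permutes_finite_permutation[OF q] S by simp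
  have permp: "permutation p" using permutes_finite_permutation[OF p] S by simp
  have qa: "?q a = b" by (simp add: pa)
  have step: "p x \<in> orbit ?q x" if x: "x \<in> S" for x
  proof (cases "p x = b")
    case True
    then have "?q x = a" by simp
    then have "?q (?q x) = p x" using qa True by simp
    then show ?thesis by (metis orbit.base orbit.step)
  next
    case False
    moreover have "p x \<noteq> a" using permutes_in_image[OF p] x S(2) by metis
    ultimately have "?q x = p x" by (simp add: transpose_apply_other)
    then show ?thesis by (metis orbit.base)
  qed
  have sub: "y \<in> S \<and> y \<in> orbit ?q x" if "y \<in> orbit p x" "x \<in> S" for x y
    using that
  proof induction
    case base
    then show ?case using step permutes_in_image[OF p] by blast
  next
    case (step y)
    then show ?case
      using \<open>\<And>x. x \<in> S \<Longrightarrow> p x \<in> orbit ?q x\<close>[of y] permutes_in_image[OF p] orbit_trans by metis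
  qed
  \<comment> \<open>an old cycle is sent to the new cycle that contains it\<close>
  define F where "F c = orbit ?q (SOME x. x \<in> c)" for c
  have F: "F (orbit p x) = orbit ?q x" if x: "x \<in> S" for x
  proof -
    have "x \<in> orbit p x" by (rule permutation_self_in_orbit[OF permp])
    then have "(SOME y. y \<in> orbit p x) \<in> orbit p x" by (rule someI)
    then show ?thesis
      using sub[OF _ x] orbit_eq_orbit[OF permq] unfolding F_def by blast
  qed
  have "orbit ?q a = orbit ?q b"
    using orbit_eq_orbit[OF permq] qa by (metis orbit.base)
  then have "orbit ?q ` insert a S = F ` orbit p ` S"
    using F b by (auto simp: image_iff)
  then show ?thesis using S(1) by (simp add: card_image_le)
qed

text \<open>The expected number of cycles of a uniform permutation is a harmonic number: each permutation of
  \<open>insert a S\<close> arises from one of \<open>S\<close> and a choice of \<open>b\<close>, and only the choice \<open>b = a\<close> adds a cycle.\<close>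

lemma sum_card_orbits_le_harmonic:
  assumes "finite S"
  shows "(\<Sum>p | p permutes S. real (card (orbit p ` S))) \<le> fact (card S) * (\<Sum>k=1..card S. 1 / real k)"
  using assms
proof (induction S rule: finite_induct)
  case empty
  then show ?case by simp
next
  case (insert a S)
  let ?n = "card S" and ?P = "{p. p permutes S}"
  have finP: "finite ?P" using insert.hyps(1) by (rule finite_permutations)
  have cardP: "card ?P = fact ?n" using card_permutations[OF refl insert.hyps(1)] .
  have inj: "inj_on (\<lambda>(b, p). Transposition.transpose a b \<circ> p) (insert a S \<times> ?P)"
  proof (rule inj_onI, clarify)
    fix b p b' p' assume *: "p permutes S" "p' permutes S" "Transposition.transpose a b \<circ> p = Transposition.transpose a b' \<circ> p'"
    have "p a = a" "p' a = a" using *(1,2) insert.hyps(2) by (auto simp: permutes_def)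
    then have b: "b = b'" using fun_cong[OF *(3), of a] by simp
    then have "Transposition.transpose a b \<circ> (Transposition.transpose a b \<circ> p) = Transposition.transpose a b \<circ> (Transposition.transpose a b \<circ> p')"
      using *(3) by simp
    then show "b = b' \<and> p = p'" using b by (simp add: o_assoc[symmetric] fun_eq_iff)
  qed
  have "(\<Sum>q | q permutes insert a S. real (card (orbit q ` insert a S)))
      = (\<Sum>(b, p)\<in>insert a S \<times> ?P. real (card (orbit (Transposition.transpose a b \<circ> p) ` insert a S)))"
  proof -
    have im: "{q. q permutes insert a S} = (\<lambda>(b, p). Transposition.transpose a b \<circ> p) ` (insert a S \<times> ?P)"
      unfolding permutes_insert by auto
    show ?thesis unfolding im by (subst sum.reindex[OF inj]) (auto intro!: sum.cong)
  qed
  also have "\<dots> = (\<Sum>b\<in>insert a S. \<Sum>p\<in>?P. real (card (orbit (Transposition.transpose a b \<circ> p) ` insert a S)))"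
    by (rule sum.cartesian_product[symmetric])
  also have "\<dots> \<le> (\<Sum>b\<in>insert a S. \<Sum>p\<in>?P. real (card (orbit p ` S)) + (if b = a then 1 else 0))"
  proof (intro sum_mono)
    fix b p assume b: "b \<in> insert a S" and "p \<in> ?P"
    then have p: "p permutes S" by simp
    show "real (card (orbit (Transposition.transpose a b \<circ> p) ` insert a S)) \<le> real (card (orbit p ` S)) + (if b = a then 1 else 0)"
    proof (cases "b = a")
      case True
      have "card (insert (orbit p a) (orbit p ` S)) \<le> Suc (card (orbit p ` S))"
        by (rule card_insert_le_m1) auto
      then show ?thesis using True by simp
    next
      case False
      then show ?thesis
        using card_orbits_transpose_le[OF p insert.hyps(1,2), of b] b by simp
    qed
  qed
  also have "\<dots> = real (Suc ?n) * (\<Sum>p\<in>?P. real (card (orbit p ` S))) + fact ?n"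
  proof -
    have "(\<Sum>b\<in>S. if b = a then 1 else 0 :: real) = 0"
      using insert.hyps(2) by (intro sum.neutral) auto
    then show ?thesis
      using insert.hyps by (simp add: sum.distrib cardP flip: sum_distrib_left)
  qed
  also have "\<dots> \<le> real (Suc ?n) * (fact ?n * (\<Sum>k=1..?n. 1 / real k)) + fact ?n"
    using insert.IH by (intro add_mono mult_left_mono) auto
  also have "\<dots> = fact (card (insert a S)) * (\<Sum>k=1..card (insert a S). 1 / real k)"
  proof -
    have "fact ?n = fact (Suc ?n) * (1 / real (Suc ?n))" by simp
    then show ?thesis using insert.hyps by (simp add: algebra_simps)
  qed
  finally show ?case .
qed

section \<open>Products and sums of products of independent entries\<close>

text \<open>If the sum reaches \<open>s\<close>, then the numbers \<open>min 1 (X a / s)\<close> add up to at least 1: either one of them is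
  1 or none is truncated. Bounding each by dyadic steps leaves only tail probabilities of the
  individual summands.\<close>

lemma emeasure_sum_ge_le_dyadic:
  fixes X :: "'i \<Rightarrow> 'a \<Rightarrow> real"
  assumes fin: "finite A" and s: "0 < s"
    and meas: "\<And>a. a \<in> A \<Longrightarrow> X a \<in> borel_measurable M"
    and nonneg: "\<And>a \<omega>. a \<in> A \<Longrightarrow> 0 \<le> X a \<omega>"
  shows "emeasure M {\<omega> \<in> space M. s \<le> (\<Sum>a\<in>A. X a \<omega>)}
    \<le> (\<Sum>j. ennreal ((1/2) ^ j) * (\<Sum>a\<in>A. emeasure M {\<omega> \<in> space M. s * (1/2) ^ Suc j \<le> X a \<omega>}))"
proof -
  let ?E = "\<lambda>a j. {\<omega> \<in> space M. s * (1/2) ^ Suc j \<le> X a \<omega>}"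
  have meas': "?E a j \<in> sets M" if "a \<in> A" for a j
    using meas[OF that] by measurable
  have term_le: "ennreal (min 1 (X a \<omega> / s)) \<le> (\<Sum>j. ennreal ((1/2) ^ j) * indicator (?E a j) \<omega>)"
    if a: "a \<in> A" and \<omega>: "\<omega> \<in> space M" for a \<omega>
  proof (cases "X a \<omega> = 0")
    case False
    then have pos: "0 < X a \<omega> / s" using nonneg[OF a, of \<omega>] s by simp
    have ex: "\<exists>j. (1/2) ^ Suc j \<le> X a \<omega> / s"
    proof -
      obtain n where "(1/2) ^ n < X a \<omega> / s"
        using real_arch_pow_inv[OF pos, of "1/2"] by auto
      moreover have "(1/2 :: real) ^ Suc n \<le> (1/2) ^ n"
        by (rule power_decreasing) auto
      ultimately show ?thesis by (intro exI[of _ n]) linarith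
    qed
    \<comment> \<open>the first dyadic level below \<open>X a \<omega> / s\<close>; minimality gives the reverse bound at the level before it\<close>
    define j where "j = (LEAST j. (1/2) ^ Suc j \<le> X a \<omega> / s)"
    have j: "(1/2) ^ Suc j \<le> X a \<omega> / s"
      unfolding j_def by (rule LeastI_ex[OF ex])
    have "min 1 (X a \<omega> / s) \<le> (1/2) ^ j"
    proof (cases j)
      case (Suc i)
      then have "\<not> (1/2) ^ Suc i \<le> X a \<omega> / s"
        using not_less_Least[of i "\<lambda>j. (1/2) ^ Suc j \<le> X a \<omega> / s"] by (auto simp: j_def)
      then have "X a \<omega> / s \<le> (1/2) ^ j" unfolding Suc by (simp only: not_le less_imp_le)
      then show ?thesis by (rule min.coboundedI2)
    qed simp
    then have "ennreal (min 1 (X a \<omega> / s)) \<le> ennreal ((1/2) ^ j) * indicator (?E a j) \<omega>"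
      using j s \<omega> by (simp add: indicator_def field_simps ennreal_leI)
    also have "\<dots> \<le> (\<Sum>j. ennreal ((1/2) ^ j) * indicator (?E a j) \<omega>)"
    proof -
      define f where "f j = ennreal ((1/2) ^ j) * indicator (?E a j) \<omega>" for j
      have "f j \<le> (\<Sum>j. f j)" using sum_le_suminf[of f "{j}"] by simp
      then show ?thesis by (simp only: f_def)
    qed
    finally show ?thesis .
  qed (use s in simp)
  have "emeasure M {\<omega> \<in> space M. s \<le> (\<Sum>a\<in>A. X a \<omega>)}
      = (\<integral>\<^sup>+\<omega>. indicator {\<omega> \<in> space M. s \<le> (\<Sum>a\<in>A. X a \<omega>)} \<omega> \<partial>M)"
    using meas by (subst nn_integral_indicator) (auto intro!: borel_measurable_le borel_measurable_sum)
  also have "\<dots> \<le> (\<integral>\<^sup>+\<omega>. (\<Sum>a\<in>A. \<Sum>j. ennreal ((1/2) ^ j) * indicator (?E a j) \<omega>) \<partial>M)"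
  proof (intro nn_integral_mono)
    fix \<omega> assume \<omega>: "\<omega> \<in> space M"
    show "indicator {\<omega> \<in> space M. s \<le> (\<Sum>a\<in>A. X a \<omega>)} \<omega>
        \<le> (\<Sum>a\<in>A. \<Sum>j. ennreal ((1/2) ^ j) * indicator (?E a j) \<omega>)"
    proof (cases "s \<le> (\<Sum>a\<in>A. X a \<omega>)")
      case True
      have "1 \<le> (\<Sum>a\<in>A. min 1 (X a \<omega> / s))"
      proof (cases "\<exists>a\<in>A. s \<le> X a \<omega>")
        case True
        then obtain a where a: "a \<in> A" "s \<le> X a \<omega>" by blast
        then have "1 = min 1 (X a \<omega> / s)" using s by (simp add: min_def)
        also have "\<dots> \<le> (\<Sum>a\<in>A. min 1 (X a \<omega> / s))"
          using a fin nonneg s by (intro member_le_sum) (auto simp: min_def)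
        finally show ?thesis .
      next
        case False
        then have "(\<Sum>a\<in>A. min 1 (X a \<omega> / s)) = (\<Sum>a\<in>A. X a \<omega> / s)"
          using s by (intro sum.cong refl) (auto simp: min_def field_simps not_le)
        also have "\<dots> = (\<Sum>a\<in>A. X a \<omega>) / s" by (simp add: sum_divide_distrib)
        finally show ?thesis using True s by simp
      qed
      then have "1 \<le> ennreal (\<Sum>a\<in>A. min 1 (X a \<omega> / s))" by (simp add: ennreal_ge_1)
      also have "\<dots> = (\<Sum>a\<in>A. ennreal (min 1 (X a \<omega> / s)))"
        using nonneg s by (intro sum_ennreal[symmetric]) auto
      also have "\<dots> \<le> (\<Sum>a\<in>A. \<Sum>j. ennreal ((1/2) ^ j) * indicator (?E a j) \<omega>)"
        using term_le \<omega> by (intro sum_mono) auto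
      finally show ?thesis using \<omega> True by simp
    qed simp
  qed
  also have "\<dots> = (\<Sum>a\<in>A. \<Sum>j. ennreal ((1/2) ^ j) * emeasure M (?E a j))"
    using meas'
    by (subst nn_integral_sum, simp, intro sum.cong refl, subst nn_integral_suminf)
       (auto simp: nn_integral_cmult)
  also have "\<dots> = (\<Sum>j. \<Sum>a\<in>A. ennreal ((1/2) ^ j) * emeasure M (?E a j))"
    by (rule suminf_sum[symmetric]) simp
  finally show ?thesis unfolding sum_distrib_left .
qed

text \<open>Used with one bound that decays in the length of a cycle and one that decays in \<open>t\<close>; the
  geometric mean decays in both.\<close>

lemma powr_interpolate:
  fixes x a b w :: real
  assumes "0 \<le> x" "x \<le> a" "x \<le> b" "0 \<le> w" "w \<le> 1"
  shows "x \<le> a powr (1 - w) * b powr w"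
proof -
  have "x = x powr (1 - w) * x powr w"
    using assms(1) by (simp add: powr_add[symmetric])
  also have "\<dots> \<le> a powr (1 - w) * b powr w"
    using assms by (intro mult_mono powr_mono2) auto
  finally show ?thesis .
qed

text \<open>The conditions on the law of one entry that the tail estimates use: \<open>r\<close> bounds the modulus from below and
  \<open>B\<close>, \<open>\<rho>\<close> are the constants of the Hoelder condition on the law of the modulus.\<close>

locale diagonal_entries = prob_space \<mu> for \<mu> :: "complex measure" +
  fixes \<theta> r B \<rho> :: real
  assumes sets_eq: "sets \<mu> = sets borel"
    and theta: "0 < \<theta>" "\<theta> < 1"
    and moment: "(\<integral>z. norm z powr (2 * \<theta>) \<partial>\<mu>) = 1"
    and r: "0 < r" "r < 1" and norm_ge: "AE z in \<mu>. r \<le> norm z"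
    and not_unimodular: "\<not> (AE z in \<mu>. norm z = 1)"
    and rho: "0 < \<rho>" and B: "0 < B"
    and small_ball: "\<And>h x. 0 < h \<Longrightarrow> 0 < x \<Longrightarrow> measure \<mu> {z. x < norm z \<and> norm z < x + h} \<le> B * h powr \<rho>"
begin

lemma sets_borel[measurable_cong]: "sets \<mu> = sets borel"
  by (rule sets_eq)

lemma space_eq: "space \<mu> = UNIV"
  using sets_eq_imp_space_eq[OF sets_eq] by simp

sublocale P: product_prob_space "\<lambda>_ :: nat. \<mu>" UNIV
  by unfold_locales

definition q :: real where
  "q = (\<integral>z. norm z powr \<theta> \<partial>\<mu>)"

lemma integrable_moment: "integrable \<mu> (\<lambda>z. norm z powr (2 * \<theta>))"
  using moment not_integrable_integral_eq by fastforce

lemma integrable_half_moment: "integrable \<mu> (\<lambda>z. norm z powr \<theta>)"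
proof (rule Bochner_Integration.integrable_bound[where f = "\<lambda>z. 1 + norm z powr (2 * \<theta>)"])
  show "integrable \<mu> (\<lambda>z. 1 + norm z powr (2 * \<theta>))"
    using integrable_moment by simp
  show "AE z in \<mu>. norm (norm z powr \<theta>) \<le> norm (1 + norm z powr (2 * \<theta>))"
  proof (rule AE_I2)
    fix z :: complex
    have "norm z powr (2 * \<theta>) = (norm z powr \<theta>)\<^sup>2"
      by (simp add: power2_eq_square powr_add[symmetric])
    moreover have "x \<le> 1 + x\<^sup>2" for x :: real
      using zero_le_power2[of "x - 1"] zero_le_power2[of x]
      unfolding power2_diff by (simp only: one_power2 mult_1_right)
    ultimately show "norm (norm z powr \<theta>) \<le> norm (1 + norm z powr (2 * \<theta>))" by simp
  qed
qed measurable

text \<open>This is the strict inequality \<open>E \<bar>d\<bar> powr \<theta> < (E \<bar>d\<bar> powr (2 * \<theta>)) powr (1/2)\<close>: expanding the square,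
  \<open>E (1 - \<bar>d\<bar> powr \<theta>)\<^sup>2 = 2 - 2 * q\<close>, and the left side is positive because \<open>\<bar>d\<bar>\<close> is not almost
  surely 1.\<close>

lemma q_less_1: "q < 1"
proof -
  let ?g = "\<lambda>z. (1 - norm z powr \<theta>)\<^sup>2"
  have sq: "norm z powr (2 * \<theta>) = (norm z powr \<theta>)\<^sup>2" for z :: complex
    by (simp add: power2_eq_square powr_add[symmetric])
  have g: "?g z = 1 - 2 * norm z powr \<theta> + norm z powr (2 * \<theta>)" for z :: complex
    unfolding sq by (simp add: power2_eq_square algebra_simps)
  have int: "integrable \<mu> ?g"
    unfolding g using integrable_moment integrable_half_moment by simp
  have val: "(\<integral>z. ?g z \<partial>\<mu>) = 2 - 2 * q"
    unfolding g q_def using integrable_moment integrable_half_moment moment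
    by (simp add: prob_space)
  have "0 \<le> (\<integral>z. ?g z \<partial>\<mu>)" by simp
  moreover have "(\<integral>z. ?g z \<partial>\<mu>) \<noteq> 0"
  proof
    assume "(\<integral>z. ?g z \<partial>\<mu>) = 0"
    then have "AE z in \<mu>. ?g z = 0"
      using integral_nonneg_eq_0_iff_AE[OF int] by simp
    then have "AE z in \<mu>. norm z = 1"
    proof eventually_elim
      case (elim z)
      then have "norm z powr \<theta> = 1" by simp
      then have "(norm z powr \<theta>) powr (1 / \<theta>) = 1" by simp
      then show ?case using theta by (simp add: powr_powr)
    qed
    then show False using not_unimodular by simp
  qed
  ultimately show ?thesis using val by simp
qed

lemma AE_nonzero: "AE z in \<mu>. z \<noteq> 0"
  using norm_ge r by (auto elim!: eventually_mono)

lemma q_pos: "0 < q"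
proof -
  have "0 \<le> q" unfolding q_def by simp
  moreover have "q \<noteq> 0"
  proof
    assume "q = 0"
    then have "AE z in \<mu>. norm z powr \<theta> = 0"
      using integral_nonneg_eq_0_iff_AE[OF integrable_half_moment] by (simp add: q_def)
    with AE_nonzero have "AE z in \<mu>. False" by eventually_elim simp
    then show False by simp
  qed
  ultimately show ?thesis by simp
qed

lemma nn_integral_half_moment: "(\<integral>\<^sup>+z. ennreal (norm z powr \<theta>) \<partial>\<mu>) = ennreal q"
  unfolding q_def using integrable_half_moment by (intro nn_integral_eq_integral) auto

lemma nn_integral_moment: "(\<integral>\<^sup>+z. ennreal (norm z powr (2 * \<theta>)) \<partial>\<mu>) = 1"
  using nn_integral_eq_integral[OF integrable_moment] moment by simp

text \<open>The probability that a product of \<open>k\<close> independent copies of \<open>\<bar>d\<bar>\<^sup>2\<close> is at least \<open>y\<close>, computed by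
  conditioning on one factor. The recursion in \<open>y\<close> makes induction on \<open>k\<close> available for bounds that hold for all \<open>y\<close>.\<close>

fun ptail :: "nat \<Rightarrow> real \<Rightarrow> ennreal" where
  "ptail 0 y = indicator {..1} y"
| "ptail (Suc k) y = (\<integral>\<^sup>+z. ptail k (y / (norm z)\<^sup>2) \<partial>\<mu>)"

lemma measurable_ptail[measurable]: "ptail k \<in> borel_measurable borel"
proof (induction k)
  case 0
  show ?case by (simp add: fun_eq_iff[of "ptail 0", simplified] cong: measurable_cong)
next
  case (Suc k)
  note [measurable] = Suc
  have "(\<lambda>y. \<integral>\<^sup>+z. ptail k (y / (norm z)\<^sup>2) \<partial>\<mu>) \<in> borel_measurable borel"
    by measurable
  then show ?case by simp
qed

lemma measurable_prod_norm:
  fixes I :: "nat set"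
  assumes "J \<subseteq> I"
  shows "(\<lambda>\<omega>. \<Prod>j\<in>J. (norm (\<omega> j))\<^sup>2) \<in> borel_measurable (Pi\<^sub>M I (\<lambda>_. \<mu>))"
    and "(\<lambda>\<omega>. \<Prod>j\<in>J. - \<omega> j) \<in> borel_measurable (Pi\<^sub>M I (\<lambda>_. \<mu>))"
    and "(\<lambda>\<omega>. \<Prod>j\<in>J. norm (\<omega> j)) \<in> borel_measurable (Pi\<^sub>M I (\<lambda>_. \<mu>))"
proof -
  have [measurable]: "(\<lambda>\<omega>. \<omega> j) \<in> borel_measurable (Pi\<^sub>M I (\<lambda>_. \<mu>))" if "j \<in> J" for j
  proof -
    have "(\<lambda>\<omega>. \<omega> j) \<in> measurable (Pi\<^sub>M I (\<lambda>_. \<mu>)) \<mu>"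
      using that assms by (intro measurable_component_singleton) auto
    then show ?thesis using measurable_cong_sets[OF refl sets_eq] by blast
  qed
  show "(\<lambda>\<omega>. \<Prod>j\<in>J. (norm (\<omega> j))\<^sup>2) \<in> borel_measurable (Pi\<^sub>M I (\<lambda>_. \<mu>))"
    by (intro borel_measurable_prod) measurable
  show "(\<lambda>\<omega>. \<Prod>j\<in>J. - \<omega> j) \<in> borel_measurable (Pi\<^sub>M I (\<lambda>_. \<mu>))"
    by (intro borel_measurable_prod) measurable
  show "(\<lambda>\<omega>. \<Prod>j\<in>J. norm (\<omega> j)) \<in> borel_measurable (Pi\<^sub>M I (\<lambda>_. \<mu>))"
    by (intro borel_measurable_prod) measurable
qed

lemma emeasure_prod_norm_ge:
  fixes J :: "nat set"
  assumes "finite J"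
  shows "emeasure (Pi\<^sub>M J (\<lambda>_. \<mu>)) {\<omega> \<in> space (Pi\<^sub>M J (\<lambda>_. \<mu>)). y \<le> (\<Prod>j\<in>J. (norm (\<omega> j))\<^sup>2)} = ptail (card J) y"
  using assms
proof (induction J arbitrary: y rule: finite_induct)
  case empty
  have "prob_space (Pi\<^sub>M {} (\<lambda>_ :: nat. \<mu>))" by (intro prob_space_PiM prob_space_axioms)
  then have *: "emeasure (Pi\<^sub>M {} (\<lambda>_ :: nat. \<mu>)) (space (Pi\<^sub>M {} (\<lambda>_ :: nat. \<mu>))) = 1"
    by (rule prob_space.emeasure_space_1)
  show ?case
  proof (cases "y \<le> 1")
    case True
    then show ?thesis using * by simp
  next
    case False
    then have "{\<omega> \<in> space (Pi\<^sub>M {} (\<lambda>_ :: nat. \<mu>)). y \<le> (\<Prod>j\<in>{}. (norm (\<omega> j))\<^sup>2)} = {}" by auto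
    then show ?thesis using False by (metis (no_types) card.empty emeasure_empty indicator_simps(2) atMost_iff ptail.simps(1))
  qed
next
  case (insert i J)
  let ?P = "\<lambda>I. Pi\<^sub>M I (\<lambda>_ :: nat. \<mu>)"
  let ?A = "{\<omega> \<in> space (?P (insert i J)). y \<le> (\<Prod>j\<in>insert i J. (norm (\<omega> j))\<^sup>2)}"
  have meas: "?A \<in> sets (?P (insert i J))"
    using measurable_prod_norm(1)[OF subset_refl, of "insert i J"] by measurable
  have "emeasure (?P (insert i J)) ?A = (\<integral>\<^sup>+\<omega>. indicator ?A \<omega> \<partial>?P (insert i J))"
    using meas by simp
  also have "\<dots> = (\<integral>\<^sup>+z. (\<integral>\<^sup>+\<omega>. indicator ?A (fun_upd \<omega> i z) \<partial>?P J) \<partial>\<mu>)"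
    using meas insert.hyps by (intro P.product_nn_integral_insert_rev) auto
  also have "\<dots> = (\<integral>\<^sup>+z. ptail (card J) (y / (norm z)\<^sup>2) \<partial>\<mu>)"
  proof (rule nn_integral_cong_AE)
    show "AE z in \<mu>. (\<integral>\<^sup>+\<omega>. indicator ?A (fun_upd \<omega> i z) \<partial>?P J) = ptail (card J) (y / (norm z)\<^sup>2)"
      using AE_nonzero
    proof eventually_elim
      case (elim z)
      have "(\<integral>\<^sup>+\<omega>. indicator ?A (fun_upd \<omega> i z) \<partial>?P J)
          = (\<integral>\<^sup>+\<omega>. indicator {\<omega> \<in> space (?P J). y / (norm z)\<^sup>2 \<le> (\<Prod>j\<in>J. (norm (\<omega> j))\<^sup>2)} \<omega> \<partial>?P J)"
      proof (intro nn_integral_cong)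
        fix \<omega> assume \<omega>: "\<omega> \<in> space (?P J)"
        have sp: "fun_upd \<omega> i z \<in> space (?P (insert i J))"
          using \<omega> by (auto simp: space_PiM space_eq PiE_def extensional_def)
        have "(\<Prod>j\<in>insert i J. (norm (fun_upd \<omega> i z j))\<^sup>2) = (norm z)\<^sup>2 * (\<Prod>j\<in>J. (norm (\<omega> j))\<^sup>2)"
          using insert.hyps by (simp add: prod.insert) (intro disjI2 prod.cong, auto)
        then show "indicator ?A (fun_upd \<omega> i z) = (indicator {\<omega> \<in> space (?P J). y / (norm z)\<^sup>2 \<le> (\<Prod>j\<in>J. (norm (\<omega> j))\<^sup>2)} \<omega> :: ennreal)"
          using elim sp \<omega> by (simp add: indicator_def divide_le_eq mult.commute)
      qed
      also have "\<dots> = emeasure (?P J) {\<omega> \<in> space (?P J). y / (norm z)\<^sup>2 \<le> (\<Prod>j\<in>J. (norm (\<omega> j))\<^sup>2)}"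
        using measurable_prod_norm(1)[OF subset_refl, of J] by (intro nn_integral_indicator) measurable
      finally show ?case using insert.IH by simp
    qed
  qed
  finally show ?case using insert.hyps by simp
qed

lemma emeasure_PiM_restrict:
  assumes "J \<subseteq> I" "finite I" and A: "{\<omega> \<in> space (Pi\<^sub>M J (\<lambda>_ :: nat. \<mu>)). Q \<omega>} \<in> sets (Pi\<^sub>M J (\<lambda>_. \<mu>))"
    and Q: "\<And>\<omega>. Q (restrict \<omega> J) \<longleftrightarrow> Q \<omega>"
  shows "emeasure (Pi\<^sub>M I (\<lambda>_ :: nat. \<mu>)) {\<omega> \<in> space (Pi\<^sub>M I (\<lambda>_. \<mu>)). Q \<omega>}
    = emeasure (Pi\<^sub>M J (\<lambda>_. \<mu>)) {\<omega> \<in> space (Pi\<^sub>M J (\<lambda>_. \<mu>)). Q \<omega>}"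
proof -
  let ?P = "\<lambda>I. Pi\<^sub>M I (\<lambda>_ :: nat. \<mu>)"
  have m: "(\<lambda>\<omega>. restrict \<omega> J) \<in> measurable (?P I) (?P J)"
    using assms(1) by (rule measurable_restrict_subset)
  have "emeasure (?P J) {\<omega> \<in> space (?P J). Q \<omega>}
      = emeasure (distr (?P I) (?P J) (\<lambda>\<omega>. restrict \<omega> J)) {\<omega> \<in> space (?P J). Q \<omega>}"
    using P.distr_restrict[OF assms(1,2)] by simp
  also have "\<dots> = emeasure (?P I) ((\<lambda>\<omega>. restrict \<omega> J) -` {\<omega> \<in> space (?P J). Q \<omega>} \<inter> space (?P I))"
    by (rule emeasure_distr[OF m A])
  also have "(\<lambda>\<omega>. restrict \<omega> J) -` {\<omega> \<in> space (?P J). Q \<omega>} \<inter> space (?P I) = {\<omega> \<in> space (?P I). Q \<omega>}"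
    using measurable_space[OF m] Q by auto
  finally show ?thesis by simp
qed

lemma emeasure_subprod_norm_ge:
  fixes I :: "nat set"
  assumes "J \<subseteq> I" "finite I"
  shows "emeasure (Pi\<^sub>M I (\<lambda>_. \<mu>)) {\<omega> \<in> space (Pi\<^sub>M I (\<lambda>_. \<mu>)). y \<le> (\<Prod>j\<in>J. (norm (\<omega> j))\<^sup>2)} = ptail (card J) y"
proof -
  have "finite J" using assms finite_subset by blast
  have "{\<omega> \<in> space (Pi\<^sub>M J (\<lambda>_ :: nat. \<mu>)). y \<le> (\<Prod>j\<in>J. (norm (\<omega> j))\<^sup>2)} \<in> sets (Pi\<^sub>M J (\<lambda>_. \<mu>))"
    using measurable_prod_norm(1)[OF subset_refl, of J] by measurable
  then show ?thesis
    using emeasure_PiM_restrict[OF assms, of "\<lambda>\<omega>. y \<le> (\<Prod>j\<in>J. (norm (\<omega> j))\<^sup>2)"]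
      emeasure_prod_norm_ge[OF \<open>finite J\<close>, of y] by (simp cong: prod.cong)
qed

lemma powr_div_norm:
  assumes "0 < y" "z \<noteq> (0 :: complex)"
  shows "(y / (norm z)\<^sup>2) powr (- a) = y powr (- a) * norm z powr (2 * a)"
proof -
  have "(norm z)\<^sup>2 = norm z powr 2" using assms(2) by simp
  then have eq: "((norm z)\<^sup>2) powr (- a) = norm z powr (- (2 * a))"
    by (simp only: powr_powr mult_minus_right)
  have "(y / (norm z)\<^sup>2) powr (- a) = y powr (- a) / ((norm z)\<^sup>2) powr (- a)"
    by (rule powr_divide)
  then show ?thesis unfolding eq by (simp add: powr_minus field_simps)
qed

text \<open>Markov's inequality for the moment of order \<open>\<theta> / 2\<close>, in the form that its recursive proof gives.\<close>

lemma ptail_le: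
  assumes "0 < y" shows "ptail k y \<le> ennreal (q ^ k * y powr (- (\<theta> / 2)))"
  using assms
proof (induction k arbitrary: y)
  case 0
  show ?case
  proof (cases "y \<le> 1")
    case True
    then have "1 powr (- (\<theta> / 2)) \<le> y powr (- (\<theta> / 2))"
      using 0 theta by (intro powr_mono2') auto
    then show ?thesis using True by (simp add: ennreal_ge_1)
  qed simp
next
  case (Suc k)
  have "ptail (Suc k) y \<le> (\<integral>\<^sup>+z. ennreal (q ^ k * y powr (- (\<theta> / 2))) * ennreal (norm z powr \<theta>) \<partial>\<mu>)"
    unfolding ptail.simps
  proof (rule nn_integral_mono_AE)
    show "AE z in \<mu>. ptail k (y / (norm z)\<^sup>2) \<le> ennreal (q ^ k * y powr (- (\<theta> / 2))) * ennreal (norm z powr \<theta>)"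
      using AE_nonzero
    proof eventually_elim
      case (elim z)
      then have "ptail k (y / (norm z)\<^sup>2) \<le> ennreal (q ^ k * (y / (norm z)\<^sup>2) powr (- (\<theta> / 2)))"
        using Suc.prems by (intro Suc.IH) simp
      also have "\<dots> = ennreal (q ^ k * y powr (- (\<theta> / 2))) * ennreal (norm z powr \<theta>)"
        using powr_div_norm[OF Suc.prems elim, of "\<theta> / 2"] q_pos by (simp add: ennreal_mult' mult.assoc)
      finally show ?case .
    qed
  qed
  also have "\<dots> = ennreal (q ^ k * y powr (- (\<theta> / 2))) * ennreal q"
    by (subst nn_integral_cmult) (auto simp: nn_integral_half_moment)
  also have "\<dots> = ennreal (q ^ Suc k * y powr (- (\<theta> / 2)))"
    using q_pos by (simp add: ennreal_mult' mult_ac)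
  finally show ?case .
qed

definition visit_const :: real where "visit_const = 1 / (1 - q)"

lemma visit_const_pos: "0 < visit_const" unfolding visit_const_def using q_less_1 by simp

text \<open>The left side, as \<open>n\<close> grows, is the expected number of times at which the walk of products is
  at least \<open>y\<close>. The right side is superharmonic for one step of the walk: \<open>y powr (- \<theta>)\<close> is harmonic and
  \<open>y powr (- (\<theta> / 2))\<close> is multiplied by \<open>q < 1\<close>. For \<open>y \<le> 1\<close>, where time 0 contributes a
  visit, the second power is the smaller one and its loss \<open>visit_const * (1 - q) * y powr (- (\<theta> / 2)) \<ge> 1\<close> pays for that visit; for
  \<open>y > 1\<close> there is nothing to pay and harmonicity of the first power is enough.\<close>

lemma sum_ptail_le_min:
  assumes "0 < y"
  shows "(\<Sum>k<n. ptail k y) \<le> ennreal (visit_const * min (y powr (- (\<theta> / 2))) (y powr (- \<theta>)))"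
  using assms
proof (induction n arbitrary: y)
  case 0
  show ?case by simp
next
  case (Suc n)
  have "(\<Sum>k<Suc n. ptail k y) = ptail 0 y + (\<Sum>k<n. ptail (Suc k) y)"
    by (rule sum.lessThan_Suc_shift)
  also have "(\<Sum>k<n. ptail (Suc k) y) = (\<integral>\<^sup>+z. (\<Sum>k<n. ptail k (y / (norm z)\<^sup>2)) \<partial>\<mu>)"
    by (subst nn_integral_sum) auto
  finally have eq: "(\<Sum>k<Suc n. ptail k y) = ptail 0 y + (\<integral>\<^sup>+z. (\<Sum>k<n. ptail k (y / (norm z)\<^sup>2)) \<partial>\<mu>)" .
  have step: "(\<integral>\<^sup>+z. (\<Sum>k<n. ptail k (y / (norm z)\<^sup>2)) \<partial>\<mu>)
      \<le> ennreal (visit_const * y powr (- a)) * (\<integral>\<^sup>+z. ennreal (norm z powr (2 * a)) \<partial>\<mu>)"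
    if a: "a = \<theta> / 2 \<or> a = \<theta>" for a
  proof -
    have "(\<integral>\<^sup>+z. (\<Sum>k<n. ptail k (y / (norm z)\<^sup>2)) \<partial>\<mu>)
        \<le> (\<integral>\<^sup>+z. ennreal (visit_const * y powr (- a)) * ennreal (norm z powr (2 * a)) \<partial>\<mu>)"
    proof (rule nn_integral_mono_AE)
      show "AE z in \<mu>. (\<Sum>k<n. ptail k (y / (norm z)\<^sup>2)) \<le> ennreal (visit_const * y powr (- a)) * ennreal (norm z powr (2 * a))"
        using AE_nonzero
      proof eventually_elim
        case (elim z)
        let ?y = "y / (norm z)\<^sup>2"
        have "(\<Sum>k<n. ptail k ?y) \<le> ennreal (visit_const * min (?y powr (- (\<theta> / 2))) (?y powr (- \<theta>)))"
          using Suc.prems elim by (intro Suc.IH) simp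
        also have "\<dots> \<le> ennreal (visit_const * ?y powr (- a))"
          using a visit_const_pos by (intro ennreal_leI mult_left_mono) auto
        also have "\<dots> = ennreal (visit_const * y powr (- a)) * ennreal (norm z powr (2 * a))"
          using powr_div_norm[OF Suc.prems elim, of a] visit_const_pos by (simp add: ennreal_mult' mult.assoc)
        finally show ?case .
      qed
    qed
    also have "\<dots> = ennreal (visit_const * y powr (- a)) * (\<integral>\<^sup>+z. ennreal (norm z powr (2 * a)) \<partial>\<mu>)"
      by (rule nn_integral_cmult) measurable
    finally show ?thesis .
  qed
  show ?case
  proof (cases "y \<le> 1")
    case True
    have ge1: "1 \<le> y powr (- (\<theta> / 2))"
      using powr_mono2'[of "- (\<theta> / 2)" y 1] True Suc.prems theta by simp
    have "y powr (- (\<theta> / 2)) \<le> y powr (- \<theta>)"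
      using True Suc.prems theta by (intro powr_mono') auto
    then have min: "min (y powr (- (\<theta> / 2))) (y powr (- \<theta>)) = y powr (- (\<theta> / 2))" by simp
    have "(\<Sum>k<Suc n. ptail k y) \<le> 1 + ennreal (visit_const * y powr (- (\<theta> / 2))) * ennreal q"
      unfolding eq using step[of "\<theta> / 2"] True nn_integral_half_moment by (intro add_mono) auto
    also have "\<dots> = ennreal (1 + visit_const * y powr (- (\<theta> / 2)) * q)"
      using visit_const_pos q_pos by (simp add: ennreal_mult'[symmetric])
    also have "\<dots> \<le> ennreal (visit_const * y powr (- (\<theta> / 2)))"
    proof (rule ennreal_leI)
      have "visit_const * (1 - q) = 1" unfolding visit_const_def using q_less_1 by simp
      moreover have "visit_const * y powr (- (\<theta> / 2)) - visit_const * y powr (- (\<theta> / 2)) * q = visit_const * (1 - q) * y powr (- (\<theta> / 2))"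
        by (simp only: algebra_simps)
      ultimately have "visit_const * y powr (- (\<theta> / 2)) - visit_const * y powr (- (\<theta> / 2)) * q = y powr (- (\<theta> / 2))" by simp
      then show "1 + visit_const * y powr (- (\<theta> / 2)) * q \<le> visit_const * y powr (- (\<theta> / 2))" using ge1 by linarith
    qed
    finally show ?thesis unfolding min .
  next
    case False
    then have "y powr (- \<theta>) \<le> y powr (- (\<theta> / 2))"
      using theta by (intro powr_mono) auto
    then have min: "min (y powr (- (\<theta> / 2))) (y powr (- \<theta>)) = y powr (- \<theta>)" by simp
    show ?thesis unfolding eq min using step[of \<theta>] False nn_integral_moment by simp
  qed
qed

lemma sum_ptail_le:
  assumes "0 < y" shows "(\<Sum>k<n. ptail k y) \<le> ennreal (visit_const * y powr (- \<theta>))"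
  using order_trans[OF sum_ptail_le_min[OF assms, of n]] visit_const_pos by (simp add: ennreal_leI)

text \<open>The constant is \<open>visit_const * 2 powr \<theta>\<close> times the geometric series of ratio \<open>2 powr (\<theta> - 1)\<close> over the
  dyadic levels.\<close>

definition energy_const :: real where "energy_const = visit_const * 2 powr \<theta> / (1 - 2 powr (\<theta> - 1))"

lemma two_powr_less_1: "2 powr (\<theta> - 1) < (1 :: real)"
  using powr_less_mono[of "\<theta> - 1" 0 "2::real"] theta by simp

lemma energy_const_pos: "0 < energy_const"
  unfolding energy_const_def using visit_const_pos two_powr_less_1 by simp

text \<open>Dyadic splitting reduces the sum to the counts of \<open>sum_ptail_le\<close>. The level \<open>s / 2 ^ (j + 1)\<close> contributes
  with weight \<open>2 powr (- j)\<close> and count of order \<open>2 powr (\<theta> * j)\<close>, and \<open>\<theta> < 1\<close> makes the levels summable, so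
  the sum has the same tail exponent as its summands.\<close>

lemma emeasure_sum_prods_ge_le:
  fixes I :: "nat set"
  assumes I: "finite I" and c: "finite c" and s: "0 < s"
    and J: "\<And>i k. i \<in> c \<Longrightarrow> k < n \<Longrightarrow> J i k \<subseteq> I \<and> card (J i k) = k"
  shows "emeasure (Pi\<^sub>M I (\<lambda>_. \<mu>)) {\<omega> \<in> space (Pi\<^sub>M I (\<lambda>_. \<mu>)). s \<le> (\<Sum>i\<in>c. \<Sum>k<n. \<Prod>j\<in>J i k. (norm (\<omega> j))\<^sup>2)}
    \<le> ennreal (energy_const * real (card c) * s powr (- \<theta>))"
proof -
  let ?M = "Pi\<^sub>M I (\<lambda>_ :: nat. \<mu>)"
  let ?X = "\<lambda>(i, k) \<omega>. \<Prod>j\<in>J i k. (norm (\<omega> j))\<^sup>2"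
  let ?A = "c \<times> {..<n}"
  have tail: "emeasure ?M {\<omega> \<in> space ?M. y \<le> ?X a \<omega>} = ptail (snd a) y" if "a \<in> ?A" for a y
    using that J emeasure_subprod_norm_ge[OF _ I] by (cases a) auto
  have geo: "0 \<le> 2 powr (\<theta> - 1)" "2 powr (\<theta> - 1) < (1 :: real)" using two_powr_less_1 by auto
  have "emeasure ?M {\<omega> \<in> space ?M. s \<le> (\<Sum>i\<in>c. \<Sum>k<n. \<Prod>j\<in>J i k. (norm (\<omega> j))\<^sup>2)}
      = emeasure ?M {\<omega> \<in> space ?M. s \<le> (\<Sum>a\<in>?A. ?X a \<omega>)}"
    by (simp add: sum.cartesian_product split_def)
  also have "\<dots> \<le> (\<Sum>j. ennreal ((1/2) ^ j) * (\<Sum>a\<in>?A. emeasure ?M {\<omega> \<in> space ?M. s * (1/2) ^ Suc j \<le> ?X a \<omega>}))"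
  proof (rule emeasure_sum_ge_le_dyadic)
    show "?X a \<in> borel_measurable ?M" if "a \<in> ?A" for a
      using that J measurable_prod_norm(1) by (cases a) auto
    show "0 \<le> ?X a \<omega>" for a \<omega> by (cases a) (auto intro: prod_nonneg)
  qed (use c s in auto)
  also have "\<dots> \<le> (\<Sum>j. ennreal (real (card c) * visit_const * 2 powr \<theta> * s powr (- \<theta>) * (2 powr (\<theta> - 1)) ^ j))"
  proof (intro suminf_le)
    fix j :: nat
    let ?y = "s * (1/2) ^ Suc j"
    have y: "0 < ?y" using s by simp
    have "(\<Sum>a\<in>?A. emeasure ?M {\<omega> \<in> space ?M. ?y \<le> ?X a \<omega>}) = (\<Sum>a\<in>?A. ptail (snd a) ?y)"
      by (intro sum.cong refl tail)
    also have "\<dots> = (\<Sum>i\<in>c. \<Sum>k<n. ptail k ?y)"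
      by (simp only: sum.cartesian_product split_def)
    also have "\<dots> \<le> (\<Sum>i\<in>c. ennreal (visit_const * ?y powr (- \<theta>)))"
      by (intro sum_mono sum_ptail_le[OF y])
    also have "\<dots> = ennreal (real (card c) * (visit_const * ?y powr (- \<theta>)))"
      using visit_const_pos by (simp add: ennreal_of_nat_eq_real_of_nat ennreal_mult')
    finally have "ennreal ((1/2) ^ j) * (\<Sum>a\<in>?A. emeasure ?M {\<omega> \<in> space ?M. ?y \<le> ?X a \<omega>})
        \<le> ennreal ((1/2) ^ j) * ennreal (real (card c) * (visit_const * ?y powr (- \<theta>)))"
      by (rule mult_left_mono) simp
    also have "\<dots> = ennreal ((1/2) ^ j * (real (card c) * (visit_const * ?y powr (- \<theta>))))"
      by (simp add: ennreal_mult')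
    also have "?y powr (- \<theta>) = s powr (- \<theta>) * 2 powr (\<theta> * real (Suc j))"
    proof -
      have "(1/2 :: real) ^ Suc j = 2 powr (- real (Suc j))"
        by (metis (no_types) inverse_eq_divide powr_minus powr_realpow power_inverse zero_less_numeral)
      then have "?y powr (- \<theta>) = s powr (- \<theta>) * (2 powr (- real (Suc j))) powr (- \<theta>)"
        using s by (simp only: powr_mult)
      then show ?thesis by (simp only: powr_powr minus_mult_minus mult.commute)
    qed
    also have "(1/2) ^ j * (real (card c) * (visit_const * (s powr (- \<theta>) * 2 powr (\<theta> * real (Suc j)))))
        = real (card c) * visit_const * 2 powr \<theta> * s powr (- \<theta>) * (2 powr (\<theta> - 1)) ^ j"
    proof -
      have "(1/2 :: real) ^ j = 2 powr (- real j)"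
        by (metis (no_types) inverse_eq_divide powr_minus powr_realpow power_inverse zero_less_numeral)
      then have "(1/2) ^ j * 2 powr (\<theta> * real (Suc j)) = 2 powr (- real j + \<theta> * real (Suc j))"
        by (simp only: powr_add)
      also have "- real j + \<theta> * real (Suc j) = \<theta> + (\<theta> - 1) * real j" by (simp add: algebra_simps)
      also have "2 powr (\<theta> + (\<theta> - 1) * real j) = 2 powr \<theta> * (2 powr (\<theta> - 1)) ^ j"
        by (simp add: powr_add powr_powr[symmetric] powr_realpow)
      finally have "(1/2) ^ j * 2 powr (\<theta> * real (Suc j)) = 2 powr \<theta> * (2 powr (\<theta> - 1)) ^ j" .
      then show ?thesis by (simp only: mult_ac)
    qed
    finally show "ennreal ((1/2) ^ j) * (\<Sum>a\<in>?A. emeasure ?M {\<omega> \<in> space ?M. ?y \<le> ?X a \<omega>})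
        \<le> ennreal (real (card c) * visit_const * 2 powr \<theta> * s powr (- \<theta>) * (2 powr (\<theta> - 1)) ^ j)" .
  qed auto
  also have "\<dots> = ennreal (\<Sum>j. real (card c) * visit_const * 2 powr \<theta> * s powr (- \<theta>) * (2 powr (\<theta> - 1)) ^ j)"
    using geo visit_const_pos by (intro suminf_ennreal2 summable_mult summable_geometric) auto
  also have "(\<Sum>j. real (card c) * visit_const * 2 powr \<theta> * s powr (- \<theta>) * (2 powr (\<theta> - 1)) ^ j)
      = energy_const * real (card c) * s powr (- \<theta>)"
    using geo by (subst suminf_mult) (auto simp: suminf_geometric energy_const_def mult_ac intro: summable_geometric)
  finally show ?thesis .
qed

text \<open>Conditionally on all factors but one, the remaining modulus must lie in an interval whose length is at most
  \<open>4 * \<epsilon>\<close> divided by the product of the others, which is at least \<open>r ^ card J\<close>.\<close>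

lemma emeasure_prod_near_1:
  fixes J :: "nat set"
  assumes J: "finite J" "J \<noteq> {}" and \<epsilon>: "0 < \<epsilon>" "\<epsilon> < 1/2"
  shows "emeasure (Pi\<^sub>M J (\<lambda>_. \<mu>)) {\<omega> \<in> space (Pi\<^sub>M J (\<lambda>_. \<mu>)). \<bar>(\<Prod>j\<in>J. norm (\<omega> j)) - 1\<bar> \<le> \<epsilon>}
    \<le> ennreal (B * (4 * \<epsilon>) powr \<rho> * r powr (- \<rho> * real (card J)))"
proof -
  obtain i I where iI: "J = insert i I" "i \<notin> I" using J(2) by (meson mk_disjoint_insert ex_in_conv)
  have I: "finite I" using J iI by simp
  let ?P = "\<lambda>I. Pi\<^sub>M I (\<lambda>_ :: nat. \<mu>)"
  let ?A = "{\<omega> \<in> space (?P (insert i I)). \<bar>(\<Prod>j\<in>insert i I. norm (\<omega> j)) - 1\<bar> \<le> \<epsilon>}"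
  let ?b = "B * (4 * \<epsilon>) powr \<rho> * r powr (- \<rho> * real (card J))"
  have meas: "?A \<in> sets (?P (insert i I))"
    using measurable_prod_norm(3)[OF subset_refl, of "insert i I"] by measurable
  have "emeasure (?P (insert i I)) ?A = (\<integral>\<^sup>+\<omega>. indicator ?A \<omega> \<partial>?P (insert i I))"
    using meas by simp
  also have "\<dots> = (\<integral>\<^sup>+\<omega>. (\<integral>\<^sup>+z. indicator ?A (fun_upd \<omega> i z) \<partial>\<mu>) \<partial>?P I)"
    using meas I iI by (intro P.product_nn_integral_insert) auto
  also have "\<dots> \<le> (\<integral>\<^sup>+\<omega>. ennreal ?b \<partial>?P I)"
  proof (rule nn_integral_mono_AE)
    have "AE \<omega> in ?P I. \<forall>j\<in>I. r \<le> norm (\<omega> j)"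
      using I norm_ge prob_space_axioms by (intro AE_finite_allI AE_PiM_component) auto
    then show "AE \<omega> in ?P I. (\<integral>\<^sup>+z. indicator ?A (fun_upd \<omega> i z) \<partial>\<mu>) \<le> ennreal ?b"
    proof eventually_elim
      case (elim \<omega>)
      define Q where "Q = (\<Prod>j\<in>I. norm (\<omega> j))"
      have "r ^ card I \<le> Q"
        unfolding Q_def using elim r prod_mono[of I "\<lambda>_. r" "\<lambda>j. norm (\<omega> j)"] by simp
      moreover have "r ^ card J \<le> r ^ card I"
        using r iI I by (intro power_decreasing) auto
      ultimately have Q: "r ^ card J \<le> Q" by simp
      then have Q0: "0 < Q" using r by (meson less_le_trans zero_less_power)
      have "(\<integral>\<^sup>+z. indicator ?A (fun_upd \<omega> i z) \<partial>\<mu>)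
          \<le> (\<integral>\<^sup>+z. indicator {z. (1 - 2 * \<epsilon>) / Q < norm z \<and> norm z < (1 - 2 * \<epsilon>) / Q + 4 * \<epsilon> / Q} z \<partial>\<mu>)"
      proof (intro nn_integral_mono)
        fix z
        have "(\<Prod>j\<in>insert i I. norm (fun_upd \<omega> i z j)) = norm z * Q"
          unfolding Q_def using iI I by (simp add: prod.insert) (intro disjI2 prod.cong, auto)
        moreover have "(1 - 2 * \<epsilon>) / Q < norm z \<and> norm z < (1 - 2 * \<epsilon>) / Q + 4 * \<epsilon> / Q"
          if "\<bar>norm z * Q - 1\<bar> \<le> \<epsilon>"
        proof -
          have "1 - 2 * \<epsilon> < norm z * Q" "norm z * Q < 1 + 2 * \<epsilon>" using that \<epsilon> by linarith+
          then show ?thesis using Q0 by (simp add: divide_less_eq less_divide_eq flip: add_divide_distrib)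
        qed
        ultimately show "indicator ?A (fun_upd \<omega> i z) \<le> (indicator {z. (1 - 2 * \<epsilon>) / Q < norm z \<and> norm z < (1 - 2 * \<epsilon>) / Q + 4 * \<epsilon> / Q} z :: ennreal)"
          by (auto simp: indicator_def)
      qed
      also have "\<dots> = emeasure \<mu> {z. (1 - 2 * \<epsilon>) / Q < norm z \<and> norm z < (1 - 2 * \<epsilon>) / Q + 4 * \<epsilon> / Q}"
        by (rule nn_integral_indicator) measurable
      also have "\<dots> \<le> ennreal (B * (4 * \<epsilon> / Q) powr \<rho>)"
        unfolding emeasure_eq_measure using \<epsilon> Q0 by (intro ennreal_leI small_ball) auto
      also have "\<dots> \<le> ennreal ?b"
      proof (rule ennreal_leI)
        have "(4 * \<epsilon> / Q) powr \<rho> = (4 * \<epsilon>) powr \<rho> * Q powr (- \<rho>)"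
          using \<epsilon> Q0 by (simp add: powr_divide powr_minus field_simps)
        also have "Q powr (- \<rho>) \<le> (r ^ card J) powr (- \<rho>)"
          using Q r rho by (intro powr_mono2') auto
        also have "(r ^ card J) powr (- \<rho>) = r powr (- \<rho> * real (card J))"
          using r by (simp add: powr_realpow[symmetric] powr_powr mult.commute)
        finally have "(4 * \<epsilon> / Q) powr \<rho> \<le> (4 * \<epsilon>) powr \<rho> * r powr (- \<rho> * real (card J))"
          by (simp add: mult_left_mono)
        then show "B * (4 * \<epsilon> / Q) powr \<rho> \<le> ?b"
          using B by (simp add: mult.assoc mult_left_mono)
      qed
      finally show ?case .
    qed
  qed
  also have "\<dots> = ennreal ?b"
    using prob_space.emeasure_space_1[OF prob_space_PiM, of I "\<lambda>_. \<mu>"] prob_space_axioms by simp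
  finally show ?thesis unfolding iI(1) .
qed

end

section \<open>The probability of a small singular value\<close>

context diagonal_entries
begin

text \<open>A small enough share of the growing factor \<open>r powr (- \<rho> * n)\<close> of the small ball estimate is absorbed by the
  decay \<open>q ^ n\<close>.\<close>

lemma ex_interpolation_weight:
  "\<exists>w. 0 < w \<and> w \<le> 1/4 \<and> r powr (- \<rho> * w) \<le> q powr (- 1/4)"
proof -
  \<comment> \<open>the second entry solves \<open>r powr (- \<rho> * w) = q powr (- 1/4)\<close>\<close>
  define w where "w = min (1/4) (ln q / (4 * \<rho> * ln r))"
  have ln: "ln q < 0" "ln r < 0" using q_less_1 q_pos r by auto
  then have "4 * \<rho> * ln r < 0" using rho by (simp add: mult_pos_neg)
  then have "0 < w" unfolding w_def using ln by (simp add: divide_neg_neg)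
  moreover have "w \<le> 1/4" unfolding w_def by simp
  moreover have "r powr (- \<rho> * w) \<le> q powr (- 1/4)"
  proof -
    have "w \<le> ln q / (4 * \<rho> * ln r)" unfolding w_def by simp
    then have "ln q \<le> w * (4 * \<rho> * ln r)"
      using \<open>4 * \<rho> * ln r < 0\<close> by (simp add: neg_le_divide_eq)
    then have "- \<rho> * w * ln r \<le> - 1/4 * ln q" by (simp add: algebra_simps)
    then show ?thesis using r q_pos unfolding powr_def by simp
  qed
  ultimately show ?thesis by blast
qed

lemma ex_bound_linear_times_power:
  "\<exists>L>0. \<forall>n. real n * q powr (real n / 2) \<le> L"
proof -
  have "norm (q powr (1/2)) < 1"
    using q_less_1 q_pos powr_less_mono2[of "1/2" q 1] by simp
  then have "(\<lambda>n. of_nat n * (q powr (1/2)) ^ n) \<longlonglongrightarrow> 0" by (rule powser_times_n_limit_0)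
  then have "Bseq (\<lambda>n. real n * (q powr (1/2)) ^ n)" using convergentI convergent_imp_Bseq by blast
  then obtain L where L: "0 < L" "\<And>n. norm (real n * (q powr (1/2)) ^ n) \<le> L" by (auto elim: BseqE)
  have "(q powr (1/2)) ^ n = q powr (real n / 2)" for n
    using q_pos by (simp add: powr_realpow[symmetric] powr_powr)
  then have "real n * q powr (real n / 2) \<le> L" for n using L(2)[of n] by simp
  then show ?thesis using L(1) by blast
qed

text \<open>The constant \<open>k\<^sub>0\<close> of the theorem: \<open>exp (- decay_rate * n)\<close> is \<open>q powr (n / 4)\<close>, the part of the decay \<open>q ^ n\<close> that
  survives both interpolations.\<close>

definition decay_rate :: real where "decay_rate = - ln q / 4"

lemma decay_rate_pos: "0 < decay_rate"
  unfolding decay_rate_def using q_less_1 q_pos by simp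

lemma exp_decay_rate: "exp (- decay_rate * real n) = q powr (real n / 4)"
  unfolding decay_rate_def powr_def using q_pos by simp

text \<open>When \<open>\<bar>P\<bar> < 1/2\<close> the tail of the energy alone gives the second term. The other case is exponentially rare in
  the length of the cycle, and interpolating that with a bound that is a power of \<open>t\<close> gives the
  first term.\<close>

lemma prob_small_cycle_le:
  "\<exists>C>0. \<exists>\<delta>>0. \<forall>(I :: nat set) c J t. finite I \<and> c \<subseteq> I \<and> c \<noteq> {} \<and>
      (\<forall>i\<in>c. \<forall>k<card c. J i k \<subseteq> I \<and> card (J i k) = k) \<and> 0 < t \<and> t < 1/16 \<longrightarrow>
    measure (Pi\<^sub>M I (\<lambda>_. \<mu>)) {\<omega> \<in> space (Pi\<^sub>M I (\<lambda>_. \<mu>)). (norm (1 - (\<Prod>j\<in>c. - \<omega> j)))\<^sup>2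
        \<le> t * (\<Sum>i\<in>c. \<Sum>k<card c. \<Prod>j\<in>J i k. (norm (\<omega> j))\<^sup>2)}
      \<le> C * exp (- decay_rate * real (card c)) * t powr \<delta> + energy_const * 4 powr \<theta> * real (card c) * t powr \<theta>"
proof -
  obtain w where w: "0 < w" "w \<le> 1/4" "r powr (- \<rho> * w) \<le> q powr (- 1/4)"
    using ex_interpolation_weight by blast
  obtain L where L: "0 < L" "\<And>n. real n * q powr (real n / 2) \<le> L"
    using ex_bound_linear_times_power by blast
  \<comment> \<open>the exponents of \<open>t\<close> that the two interpolations below leave\<close>
  define \<delta> where "\<delta> = min (\<rho> * w / 4) (\<theta> / 4)"
  define c4 where "c4 = (1/4 :: real) powr (- (\<theta> / 2))"
  define Ca where "Ca = c4 powr (1 - w) * (B * 4 powr \<rho>) powr w"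
  define Cb where "Cb = (c4 * energy_const * L) powr (1/2)"
  have c4: "0 < c4" unfolding c4_def by simp
  have pos: "0 < Ca" "0 < Cb" unfolding Ca_def Cb_def using c4 B energy_const_pos L by auto
  have \<delta>: "0 < \<delta>" unfolding \<delta>_def using rho w theta by simp
  have main: "measure (Pi\<^sub>M I (\<lambda>_. \<mu>)) {\<omega> \<in> space (Pi\<^sub>M I (\<lambda>_. \<mu>)). (norm (1 - (\<Prod>j\<in>c. - \<omega> j)))\<^sup>2
        \<le> t * (\<Sum>i\<in>c. \<Sum>k<card c. \<Prod>j\<in>J i k. (norm (\<omega> j))\<^sup>2)}
      \<le> (Ca + Cb) * exp (- decay_rate * real (card c)) * t powr \<delta> + energy_const * 4 powr \<theta> * real (card c) * t powr \<theta>"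
    if I: "finite I" and cI: "c \<subseteq> I" "c \<noteq> {}"
      and J: "\<And>i k. i \<in> c \<Longrightarrow> k < card c \<Longrightarrow> J i k \<subseteq> I \<and> card (J i k) = k"
      and t: "0 < t" "t < 1/16"
    for I c :: "nat set" and J t
  proof -
    define M where "M = Pi\<^sub>M I (\<lambda>_ :: nat. \<mu>)"
    define n where "n = card c"
    define Z where "Z \<omega> = (\<Sum>i\<in>c. \<Sum>k<card c. \<Prod>j\<in>J i k. (norm (\<omega> j))\<^sup>2)" for \<omega> :: "nat \<Rightarrow> complex"
    interpret M: prob_space M
      unfolding M_def by (intro prob_space_PiM prob_space_axioms)
    have fin: "finite c" using I cI finite_subset by blast
    have n: "0 < n" unfolding n_def using fin cI by (simp add: card_gt_0_iff)
    have Zm[measurable]: "Z \<in> borel_measurable M"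
      unfolding Z_def[abs_def] M_def using J
      by (intro borel_measurable_sum measurable_prod_norm(1)) auto
    have Pm[measurable]: "(\<lambda>\<omega>. \<Prod>j\<in>c. - \<omega> j) \<in> borel_measurable M"
      "(\<lambda>\<omega>. \<Prod>j\<in>c. norm (\<omega> j)) \<in> borel_measurable M" "(\<lambda>\<omega>. \<Prod>j\<in>c. (norm (\<omega> j))\<^sup>2) \<in> borel_measurable M"
      unfolding M_def by (intro measurable_prod_norm cI)+
    define E1 where "E1 = {\<omega> \<in> space M. 1 / (4 * t) \<le> Z \<omega>}"
    define F where "F = {\<omega> \<in> space M. 1/4 \<le> (\<Prod>j\<in>c. (norm (\<omega> j))\<^sup>2)}"
    define E2 where "E2 = {\<omega> \<in> space M. \<bar>(\<Prod>j\<in>c. norm (\<omega> j)) - 1\<bar> \<le> t powr (1/4)}"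
    define E3 where "E3 = {\<omega> \<in> space M. t powr (- 1/2) \<le> Z \<omega>}"
    have [measurable]: "E1 \<in> sets M" "F \<in> sets M" "E2 \<in> sets M" "E3 \<in> sets M"
      unfolding E1_def F_def E2_def E3_def by measurable
    have quarter: "t powr (1/4) < 1/2"
    proof -
      have "t powr (1/4) < (1/16) powr (1/4)" using t by (intro powr_less_mono2) auto
      also have "(1/16 :: real) = (1/2) powr 4" by (simp add: power_numeral_reduce)
      also have "((1/2 :: real) powr 4) powr (1/4) = 1/2" by (simp only: powr_powr) simp
      finally show ?thesis .
    qed
    \<comment> \<open>\<open>E1\<close> accounts for the products of modulus below 1/2; \<open>F\<close> is the event of modulus at least 1/2, in terms of squares\<close>
    have sub: "{\<omega> \<in> space M. (norm (1 - (\<Prod>j\<in>c. - \<omega> j)))\<^sup>2 \<le> t * Z \<omega>} \<subseteq> E1 \<union> ((F \<inter> E2) \<union> (F \<inter> E3))"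
    proof (rule subsetI)
      fix \<omega> assume "\<omega> \<in> {\<omega> \<in> space M. (norm (1 - (\<Prod>j\<in>c. - \<omega> j)))\<^sup>2 \<le> t * Z \<omega>}"
      then have \<omega>: "\<omega> \<in> space M" and le: "(norm (1 - (\<Prod>j\<in>c. - \<omega> j)))\<^sup>2 \<le> t * Z \<omega>" by auto
      let ?Q = "\<Prod>j\<in>c. norm (\<omega> j)"
      have Qn: "norm (\<Prod>j\<in>c. - \<omega> j) = ?Q" by (simp add: prod_norm[symmetric])
      have Q0: "0 \<le> ?Q" by (intro prod_nonneg) auto
      have dist: "\<bar>?Q - 1\<bar> \<le> norm (1 - (\<Prod>j\<in>c. - \<omega> j))"
        using norm_triangle_ineq3[of 1 "\<Prod>j\<in>c. - \<omega> j"] unfolding Qn by simp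
      show "\<omega> \<in> E1 \<union> ((F \<inter> E2) \<union> (F \<inter> E3))"
      proof (cases "?Q < 1/2")
        case True
        then have "1/2 \<le> norm (1 - (\<Prod>j\<in>c. - \<omega> j))" using dist by linarith
        then have "(1/2)\<^sup>2 \<le> (norm (1 - (\<Prod>j\<in>c. - \<omega> j)))\<^sup>2" by (intro power_mono) auto
        then have "1/4 \<le> t * Z \<omega>" using le by (simp add: power2_eq_square)
        then show ?thesis using \<omega> t by (simp add: E1_def field_simps)
      next
        case False
        then have "(1/2)\<^sup>2 \<le> ?Q\<^sup>2" by (intro power_mono) auto
        then have "\<omega> \<in> F" using \<omega> by (simp add: F_def prod_power_distrib power2_eq_square)
        moreover have "\<omega> \<in> E2" if "\<omega> \<notin> E3"
        proof -
          have "Z \<omega> < t powr (- 1/2)" using that \<omega> by (simp add: E3_def)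
          then have "t * Z \<omega> \<le> t powr 1 * t powr (- 1/2)" using t by simp
          also have "\<dots> = (t powr (1/4))\<^sup>2"
            by (simp only: power2_eq_square powr_add[symmetric]) simp
          finally have "(norm (1 - (\<Prod>j\<in>c. - \<omega> j)))\<^sup>2 \<le> (t powr (1/4))\<^sup>2" using le by linarith
          then have "norm (1 - (\<Prod>j\<in>c. - \<omega> j)) \<le> t powr (1/4)"
            by (rule power2_le_imp_le) simp
          then show ?thesis using dist \<omega> by (simp add: E2_def)
        qed
        ultimately show ?thesis by blast
      qed
    qed
    have Zb: "measure M {\<omega> \<in> space M. s \<le> Z \<omega>} \<le> energy_const * real n * s powr (- \<theta>)" if "0 < s" for s
      using emeasure_sum_prods_ge_le[OF I fin that, of "card c" J] J energy_const_pos
      unfolding Z_def M_def[symmetric] n_def[symmetric] M.emeasure_eq_measure by simp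
    have b1: "measure M E1 \<le> energy_const * 4 powr \<theta> * real n * t powr \<theta>"
    proof -
      have "(1 / (4 * t)) powr (- \<theta>) = 4 powr \<theta> * t powr \<theta>"
        using t by (simp add: powr_divide powr_minus powr_mult field_simps)
      then show ?thesis using Zb[of "1 / (4 * t)"] t unfolding E1_def by (simp add: mult_ac)
    qed
    have b3: "measure M E3 \<le> energy_const * real n * t powr (\<theta> / 2)"
      using Zb[of "t powr (- 1/2)"] t unfolding E3_def by (simp add: powr_powr)
    have bF: "measure M F \<le> q powr real n * c4"
    proof -
      have "emeasure M F = ptail n (1/4)"
        unfolding F_def M_def n_def by (rule emeasure_subprod_norm_ge[OF cI(1) I])
      also have "\<dots> \<le> ennreal (q ^ n * c4)" unfolding c4_def by (rule ptail_le) simp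
      finally show ?thesis
        unfolding M.emeasure_eq_measure using q_pos c4 by (simp add: powr_realpow)
    qed
    have b2: "measure M E2 \<le> B * (4 * t powr (1/4)) powr \<rho> * r powr (- \<rho> * real n)"
    proof -
      have "{\<omega> \<in> space (Pi\<^sub>M c (\<lambda>_. \<mu>)). \<bar>(\<Prod>j\<in>c. norm (\<omega> j)) - 1\<bar> \<le> t powr (1/4)} \<in> sets (Pi\<^sub>M c (\<lambda>_. \<mu>))"
        using measurable_prod_norm(3)[OF subset_refl, of c] by measurable
      then have "emeasure M E2 = emeasure (Pi\<^sub>M c (\<lambda>_. \<mu>)) {\<omega> \<in> space (Pi\<^sub>M c (\<lambda>_. \<mu>)). \<bar>(\<Prod>j\<in>c. norm (\<omega> j)) - 1\<bar> \<le> t powr (1/4)}"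
        unfolding E2_def M_def by (intro emeasure_PiM_restrict[OF cI(1) I]) (simp_all cong: prod.cong)
      also have "\<dots> \<le> ennreal (B * (4 * t powr (1/4)) powr \<rho> * r powr (- \<rho> * real n))"
        unfolding n_def using fin cI(2) t quarter by (intro emeasure_prod_near_1) auto
      finally show ?thesis
        unfolding M.emeasure_eq_measure using B by simp
    qed
    have qn: "q powr (real n / 2) \<le> q powr (real n / 4)"
      using q_pos q_less_1 by (intro powr_mono') auto
    have F2: "measure M (F \<inter> E2) \<le> Ca * q powr (real n / 4) * t powr (\<rho> * w / 4)"
    proof -
      have "measure M (F \<inter> E2) \<le> (q powr real n * c4) powr (1 - w) * (B * (4 * t powr (1/4)) powr \<rho> * r powr (- \<rho> * real n)) powr w"
        using order_trans[OF M.finite_measure_mono bF] order_trans[OF M.finite_measure_mono b2] w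
        by (intro powr_interpolate) auto
      also have "\<dots> = Ca * (q powr (real n * (1 - w)) * r powr (- \<rho> * w * real n)) * t powr (\<rho> * w / 4)"
      proof -
        have "(4 * t powr (1/4)) powr \<rho> = 4 powr \<rho> * t powr (\<rho> / 4)"
          by (subst powr_mult) (simp_all add: powr_powr)
        moreover have "(t powr (\<rho> / 4)) powr w = t powr (\<rho> * w / 4)" by (simp add: powr_powr)
        moreover have "(r powr (- \<rho> * real n)) powr w = r powr (- \<rho> * w * real n)" by (simp add: powr_powr mult_ac)
        moreover have "(q powr real n) powr (1 - w) = q powr (real n * (1 - w))" by (simp add: powr_powr)
        ultimately show ?thesis
          unfolding Ca_def using B c4 by (simp only: powr_mult) (simp only: mult_ac)
      qed
      also have "\<dots> \<le> Ca * q powr (real n / 4) * t powr (\<rho> * w / 4)"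
      proof -
        have "r powr (- \<rho> * w * real n) = (r powr (- \<rho> * w)) powr real n" by (simp add: powr_powr)
        also have "\<dots> \<le> (q powr (- 1/4)) powr real n" using w(3) by (intro powr_mono2) auto
        also have "\<dots> = q powr (- real n / 4)" by (simp add: powr_powr)
        finally have 1: "r powr (- \<rho> * w * real n) \<le> q powr (- real n / 4)" .
        have "real n * (3/4) \<le> real n * (1 - w)" using w(2) by (intro mult_left_mono) auto
        then have 2: "q powr (real n * (1 - w)) \<le> q powr (real n * (3/4))"
          using q_pos q_less_1 by (intro powr_mono') auto
        have "q powr (real n * (1 - w)) * r powr (- \<rho> * w * real n)
            \<le> q powr (real n * (3/4)) * q powr (- real n / 4)"
          using 1 2 by (intro mult_mono) auto
        also have "\<dots> = q powr (real n / 2)" by (simp flip: powr_add)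
        also note qn
        finally show ?thesis using pos(1) by (intro mult_right_mono mult_left_mono) auto
      qed
      finally show ?thesis .
    qed
    have F3: "measure M (F \<inter> E3) \<le> Cb * q powr (real n / 4) * t powr (\<theta> / 4)"
    proof -
      have "measure M (F \<inter> E3) \<le> (q powr real n * c4) powr (1 - 1/2) * (energy_const * real n * t powr (\<theta> / 2)) powr (1/2)"
        using order_trans[OF M.finite_measure_mono bF] order_trans[OF M.finite_measure_mono b3]
        by (intro powr_interpolate) auto
      also have "\<dots> = (c4 * energy_const * (real n * q powr (real n / 2))) powr (1/2) * q powr (real n / 4) * t powr (\<theta> / 4)"
      proof -
        have "q powr real n = q powr (real n / 2) * q powr (real n / 2)" by (simp flip: powr_add)
        moreover have "(q powr (real n / 2)) powr (1/2) = q powr (real n / 4)" by (simp add: powr_powr)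
        moreover have "(t powr (\<theta> / 2)) powr (1/2) = t powr (\<theta> / 4)" by (simp add: powr_powr)
        moreover have "(1 - 1/2 :: real) = 1/2" by simp
        ultimately show ?thesis
          using energy_const_pos c4 by (simp only: powr_mult) (simp only: mult_ac)
      qed
      also have "\<dots> \<le> Cb * q powr (real n / 4) * t powr (\<theta> / 4)"
        unfolding Cb_def using L(2)[of n] c4 energy_const_pos
        by (intro mult_right_mono powr_mono2 mult_left_mono) auto
      finally show ?thesis .
    qed
    have t\<delta>: "t powr (\<rho> * w / 4) \<le> t powr \<delta>" "t powr (\<theta> / 4) \<le> t powr \<delta>"
      using t unfolding \<delta>_def by (intro powr_mono'; simp)+
    have "measure M {\<omega> \<in> space M. (norm (1 - (\<Prod>j\<in>c. - \<omega> j)))\<^sup>2 \<le> t * Z \<omega>}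
        \<le> measure M (E1 \<union> ((F \<inter> E2) \<union> (F \<inter> E3)))"
      by (intro M.finite_measure_mono sub) measurable
    also have "\<dots> \<le> measure M E1 + measure M ((F \<inter> E2) \<union> (F \<inter> E3))"
      by (intro measure_Un_le) measurable
    also have "measure M ((F \<inter> E2) \<union> (F \<inter> E3)) \<le> measure M (F \<inter> E2) + measure M (F \<inter> E3)"
      by (intro measure_Un_le) measurable
    also have "measure M (F \<inter> E2) \<le> Ca * q powr (real n / 4) * t powr \<delta>"
      using F2 t\<delta>(1) pos(1) by (elim order_trans) (intro mult_left_mono, auto)
    also have "measure M (F \<inter> E3) \<le> Cb * q powr (real n / 4) * t powr \<delta>"
      using F3 t\<delta>(2) pos(2) by (elim order_trans) (intro mult_left_mono, auto)
    also note b1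
    finally show ?thesis
      unfolding M_def[symmetric] Z_def exp_decay_rate n_def[symmetric]
      by (simp add: algebra_simps)
  qed
  show ?thesis
    by (intro exI[of _ "Ca + Cb"] conjI exI[of _ \<delta>] allI impI; (elim conjE)?)
       (use pos \<delta> main in auto)
qed

lemma measurable_entry_diag_law:
  assumes "i < N" shows "(\<lambda>d. d i) \<in> borel_measurable (diag_law \<mu> N)"
proof -
  have "(\<lambda>d. d i) \<in> measurable (diag_law \<mu> N) \<mu>"
    unfolding diag_law_def using assms by (intro measurable_component_singleton) auto
  then show ?thesis using measurable_cong_sets[OF refl sets_eq] by blast
qed

lemma measurable_s_min_diag_law:
  assumes "0 < N"
  shows "(\<lambda>d. s_min (diag_plus_perm N d \<sigma>)) \<in> borel_measurable (diag_law \<mu> N)"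
proof (rule measurable_s_min[OF diag_plus_perm_carrier assms])
  fix i j assume ij: "i < N" "j < N"
  show "(\<lambda>d. diag_plus_perm N d \<sigma> $$ (i, j)) \<in> borel_measurable (diag_law \<mu> N)"
    unfolding diag_plus_perm_index[OF ij] using measurable_entry_diag_law[OF ij(1)] by measurable
qed

lemma prob_space_diag_law: "prob_space (diag_law \<mu> N)"
  unfolding diag_law_def by (intro prob_space_PiM prob_space_axioms)

text \<open>A union bound over the cycles. Restricting to \<open>t < 1/16\<close> in the bound for one cycle is harmless,
  since for larger \<open>t\<close> the term \<open>C * N * t powr \<theta>\<close> already exceeds 1.\<close>

theorem prob_s_min_le:
  "\<exists>\<delta>0>0. \<exists>C\<ge>1. \<forall>\<delta> N \<sigma> t. 0 < \<delta> \<and> \<delta> < \<delta>0 \<and> 1 \<le> N \<and> \<sigma> permutes {..<N} \<and> 0 < t \<longrightarrow>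
    \<P>(d in diag_law \<mu> N. (s_min (diag_plus_perm N d \<sigma>))\<^sup>2 \<le> t)
      \<le> C * cycle_sum decay_rate N \<sigma> * t powr \<delta> + C * real N * t powr \<theta>"
proof -
  define bad where "bad I c J t = {\<omega> \<in> space (Pi\<^sub>M I (\<lambda>_ :: nat. \<mu>)). (norm (1 - (\<Prod>j\<in>c. - \<omega> j)))\<^sup>2
      \<le> t * (\<Sum>i\<in>c. \<Sum>k<card c. \<Prod>j\<in>J i k. (norm (\<omega> j))\<^sup>2)}" for I c and J :: "nat \<Rightarrow> nat \<Rightarrow> nat set" and t
  obtain C \<delta>0 where C: "0 < C" and \<delta>0: "0 < \<delta>0"
    and bound_all: "\<forall>I c J t. finite I \<and> c \<subseteq> I \<and> c \<noteq> {} \<and>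
      (\<forall>i\<in>c. \<forall>k<card c. J i k \<subseteq> I \<and> card (J i k) = k) \<and> 0 < t \<and> t < 1/16 \<longrightarrow>
    measure (Pi\<^sub>M I (\<lambda>_. \<mu>)) (bad I c J t)
      \<le> C * exp (- decay_rate * real (card c)) * t powr \<delta>0 + energy_const * 4 powr \<theta> * real (card c) * t powr \<theta>"
    using prob_small_cycle_le unfolding bad_def[symmetric] by (elim exE conjE)
  define C' where "C' = C + energy_const * 4 powr \<theta> + 16 powr \<theta>"
  have C': "C \<le> C'" "energy_const * 4 powr \<theta> \<le> C'" "16 powr \<theta> \<le> C'"
    unfolding C'_def using C energy_const_pos by auto
  have "1 \<le> (16 :: real) powr \<theta>" using theta by (intro ge_one_powr_ge_zero) auto
  then have C'1: "1 \<le> C'" using C'(3) by linarith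
  have "\<P>(d in diag_law \<mu> N. (s_min (diag_plus_perm N d \<sigma>))\<^sup>2 \<le> t)
      \<le> C' * cycle_sum decay_rate N \<sigma> * t powr \<delta> + C' * real N * t powr \<theta>"
    if \<delta>: "0 < \<delta>" "\<delta> < \<delta>0" and N: "1 \<le> N" and \<sigma>: "\<sigma> permutes {..<N}" and t: "0 < t" for \<delta> N \<sigma> t
  proof (cases "t < 1/16")
    case False
    interpret D: prob_space "diag_law \<mu> N" by (rule prob_space_diag_law)
    have "1 \<le> (16 * t) powr \<theta>" using False theta by (intro ge_one_powr_ge_zero) auto
    also have "\<dots> = 16 powr \<theta> * t powr \<theta>" by (rule powr_mult)
    also have "\<dots> \<le> C' * real N * t powr \<theta>"
    proof (intro mult_right_mono)
      show "16 powr \<theta> \<le> C' * real N"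
        using C'(3) C'1 N mult_left_mono[of 1 "real N" C'] by linarith
    qed simp
    finally have "1 \<le> C' * real N * t powr \<theta>" .
    moreover have "0 \<le> C' * cycle_sum decay_rate N \<sigma> * t powr \<delta>"
      using C'1 cycle_sum_nonneg by simp
    ultimately show ?thesis using D.prob_le_1 by (smt (verit, best))
  next
    case True
    let ?M = "Pi\<^sub>M {..<N} (\<lambda>_ :: nat. \<mu>)" and ?O = "orbit \<sigma> ` {..<N}"
    interpret D: prob_space ?M using prob_space_diag_law[of N] unfolding diag_law_def .
    have bad: "bad {..<N} c (cycle_tail \<sigma>) t
        = {d \<in> space ?M. (norm (1 - (\<Prod>j\<in>c. - d j)))\<^sup>2 \<le> t * cycle_energy d \<sigma> c}" for c
      unfolding bad_def cycle_energy_def ..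
    let ?bad = "\<lambda>c. bad {..<N} c (cycle_tail \<sigma>) t"
    have O: "c \<subseteq> {..<N} \<and> c \<noteq> {} \<and> (\<forall>i\<in>c. i < N \<and> c = orbit \<sigma> i)" if "c \<in> ?O" for c
    proof -
      from that obtain i where i: "i < N" "c = orbit \<sigma> i" by auto
      then have "c \<subseteq> {..<N}" using orbit_subset_permutes[OF \<sigma>] by simp
      moreover have "c = orbit \<sigma> j" if "j \<in> c" for j
        using orbit_eq_orbit[OF permutes_finite_permutation[OF \<sigma> finite_lessThan]] that i(2) by simp
      ultimately show ?thesis using i(2) orbit_nonempty[of \<sigma> i] by blast
    qed
    have tails: "cycle_tail \<sigma> i k \<subseteq> {..<N} \<and> card (cycle_tail \<sigma> i k) = k"
      if "c \<in> ?O" "i \<in> c" "k < card c" for c i k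
      using cycle_tail_props[OF \<sigma>, of i k] O[OF that(1)] that(2,3) by auto
    have badm: "?bad c \<in> sets ?M" if c: "c \<in> ?O" for c
    proof -
      have [measurable]: "(\<lambda>d. cycle_energy d \<sigma> c) \<in> borel_measurable ?M"
        unfolding cycle_energy_def using tails[OF c]
        by (intro borel_measurable_sum measurable_prod_norm(1)) auto
      have [measurable]: "(\<lambda>d. \<Prod>j\<in>c. - d j) \<in> borel_measurable ?M"
        using O[OF c] by (intro measurable_prod_norm(2)) auto
      show ?thesis unfolding bad by measurable
    qed
    have "\<P>(d in diag_law \<mu> N. (s_min (diag_plus_perm N d \<sigma>))\<^sup>2 \<le> t) \<le> measure ?M (\<Union>c\<in>?O. ?bad c)"
      unfolding diag_law_def
    proof (rule D.finite_measure_mono)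
      show "{d \<in> space ?M. (s_min (diag_plus_perm N d \<sigma>))\<^sup>2 \<le> t} \<subseteq> (\<Union>c\<in>?O. ?bad c)"
      proof
        fix d assume d: "d \<in> {d \<in> space ?M. (s_min (diag_plus_perm N d \<sigma>))\<^sup>2 \<le> t}"
        then obtain c where "c \<in> ?O" "(norm (1 - (\<Prod>j\<in>c. - d j)))\<^sup>2 \<le> t * cycle_energy d \<sigma> c"
          using small_s_min_imp_small_cycle[OF \<sigma>, of d t] N by auto
        then show "d \<in> (\<Union>c\<in>?O. ?bad c)" using d unfolding bad by blast
      qed
      show "(\<Union>c\<in>?O. ?bad c) \<in> sets ?M" using badm by (intro sets.finite_UN) auto
    qed
    also have "\<dots> \<le> (\<Sum>c\<in>?O. measure ?M (?bad c))"
      using badm by (intro D.finite_measure_subadditive_finite) auto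
    also have "\<dots> \<le> (\<Sum>c\<in>?O. C * exp (- decay_rate * real (card c)) * t powr \<delta>0
        + energy_const * 4 powr \<theta> * real (card c) * t powr \<theta>)"
    proof (rule sum_mono)
      fix c assume c: "c \<in> ?O"
      show "measure ?M (?bad c) \<le> C * exp (- decay_rate * real (card c)) * t powr \<delta>0
          + energy_const * 4 powr \<theta> * real (card c) * t powr \<theta>"
        using O[OF c] tails[OF c] t True by (intro bound_all[rule_format]) blast
    qed
    also have "\<dots> = C * cycle_sum decay_rate N \<sigma> * t powr \<delta>0 + energy_const * 4 powr \<theta> * real N * t powr \<theta>"
    proof -
      have "real N = (\<Sum>c\<in>?O. real (card c))"
        using sum_card_orbits[OF \<sigma>] by (metis of_nat_sum)
      then show ?thesis
        unfolding cycle_sum_def sum.distrib by (simp only: sum_distrib_left sum_distrib_right)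
    qed
    also have "\<dots> \<le> C' * cycle_sum decay_rate N \<sigma> * t powr \<delta> + C' * real N * t powr \<theta>"
    proof -
      have "t powr \<delta>0 \<le> t powr \<delta>" using t True \<delta> by (intro powr_mono') auto
      then show ?thesis
        using C' C'1 cycle_sum_nonneg[of decay_rate N \<sigma>] by (intro add_mono mult_mono mult_right_mono) auto
    qed
    finally show ?thesis .
  qed
  then show ?thesis using \<delta>0 C'1 by blast
qed

end

section \<open>Rescaled sequences and random permutations\<close>

text \<open>The deterministic and the random choice of permutations satisfy the same kind of bound, with
  \<open>l N\<close> the value or an upper bound of the mean of \<open>L(k\<^sub>0, \<sigma>\<^sub>N)\<close>; what follows from
  it about the rescaled sequence depends only on this bound.\<close>

locale small_ball_sequence =
  fixes M :: "nat \<Rightarrow> 'a measure" and X :: "nat \<Rightarrow> 'a \<Rightarrow> real" and l :: "nat \<Rightarrow> real" and C \<delta> \<theta> :: real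
  assumes prob_spaces: "\<And>N. 1 \<le> N \<Longrightarrow> prob_space (M N)"
    and meas: "\<And>N. 1 \<le> N \<Longrightarrow> X N \<in> borel_measurable (M N)"
    and nonneg: "\<And>N \<omega>. 1 \<le> N \<Longrightarrow> 0 \<le> X N \<omega>"
    and bound: "\<And>N t. 1 \<le> N \<Longrightarrow> 0 < t \<Longrightarrow>
      measure (M N) {\<omega> \<in> space (M N). (X N \<omega>)\<^sup>2 \<le> t} \<le> C * l N * t powr \<delta> + C * real N * t powr \<theta>"
    and C: "0 \<le> C" and exponents: "0 < \<delta>" "0 < \<theta>"
    and l: "l \<in> o(\<lambda>N. real N powr (\<delta> / \<theta>))"
begin

lemma AE_pos:
  assumes N: "1 \<le> N" shows "AE \<omega> in M N. 0 < X N \<omega>"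
proof -
  interpret prob_space "M N" using prob_spaces[OF N] .
  note [measurable] = meas[OF N]
  let ?A = "{\<omega> \<in> space (M N). X N \<omega> \<le> 0}"
  have le: "measure (M N) ?A \<le> C * l N * t powr \<delta> + C * real N * t powr \<theta>" if "0 < t" for t
  proof -
    have "measure (M N) ?A \<le> measure (M N) {\<omega> \<in> space (M N). (X N \<omega>)\<^sup>2 \<le> t}"
    proof (rule finite_measure_mono)
      show "?A \<subseteq> {\<omega> \<in> space (M N). (X N \<omega>)\<^sup>2 \<le> t}"
      proof
        fix \<omega> assume \<omega>: "\<omega> \<in> ?A"
        then have "X N \<omega> = 0" using nonneg[OF N, of \<omega>] by simp
        then show "\<omega> \<in> {\<omega> \<in> space (M N). (X N \<omega>)\<^sup>2 \<le> t}" using \<omega> that by simp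
      qed
      show "{\<omega> \<in> space (M N). (X N \<omega>)\<^sup>2 \<le> t} \<in> sets (M N)" by measurable
    qed
    then show ?thesis using bound[OF N that] by linarith
  qed
  have pw: "((\<lambda>t. t powr a) \<longlongrightarrow> 0) (at_right 0)" if "0 < a" for a :: real
    using that by real_asymp
  have "((\<lambda>t. C * l N * t powr \<delta> + C * real N * t powr \<theta>) \<longlongrightarrow> C * l N * 0 + C * real N * 0) (at_right 0)"
    using exponents by (intro tendsto_intros pw)
  then have "measure (M N) ?A \<le> C * l N * 0 + C * real N * 0"
    by (rule tendsto_lowerbound) (auto simp: eventually_at_right_less intro: eventually_mono[OF eventually_at_right_less le])
  then have "prob ?A = 0" by (simp add: measure_le_0_iff)
  then have "AE \<omega> in M N. \<omega> \<notin> ?A"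
    by (subst (asm) prob_eq_0) auto
  then show ?thesis by (auto simp: not_le elim!: AE_mp)
qed

lemma scaled_bound:
  assumes N: "2 \<le> N" and v: "0 < v"
  shows "measure (M N) {\<omega> \<in> space (M N). (X N \<omega>)\<^sup>2 \<le> v / (real N powr (1 / \<theta>) * ln (real N))}
    \<le> C * (l N / real N powr (\<delta> / \<theta>)) * v powr \<delta> * ln (real N) powr (- \<delta>) + C * v powr \<theta> * ln (real N) powr (- \<theta>)"
proof -
  let ?t = "v / (real N powr (1 / \<theta>) * ln (real N))"
  have ln: "0 < ln (real N)" using N by simp
  have t: "0 < ?t" using v ln N by simp
  have pw: "?t powr a = v powr a / real N powr (a / \<theta>) * ln (real N) powr (- a)" for a
    by (simp add: powr_divide powr_mult powr_powr powr_minus field_simps)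
  have "C * real N * ?t powr \<theta> = C * v powr \<theta> * ln (real N) powr (- \<theta>)"
    unfolding pw using exponents N by simp
  moreover have "C * l N * ?t powr \<delta> = C * (l N / real N powr (\<delta> / \<theta>)) * v powr \<delta> * ln (real N) powr (- \<delta>)"
    unfolding pw by simp
  moreover have "measure (M N) {\<omega> \<in> space (M N). (X N \<omega>)\<^sup>2 \<le> ?t} \<le> C * l N * ?t powr \<delta> + C * real N * ?t powr \<theta>"
    using N t by (intro bound) simp_all
  ultimately show ?thesis by (simp only:)
qed

lemma l_ratio_tendsto: "(\<lambda>N. l N / real N powr (\<delta> / \<theta>)) \<longlonglongrightarrow> 0"
  using l by (rule smalloD_tendsto)

text \<open>At the scale \<open>N powr (1 / \<theta>) * ln N\<close> the first term of the bound is \<open>l N / N powr (\<delta> / \<theta>)\<close> up to bounded factors, and the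
  second one is a multiple of \<open>ln N powr (- \<theta>)\<close>.\<close>

lemma limsup_scaled:
  assumes u: "0 < u"
  shows "limsup (\<lambda>N. ereal (measure (M N) {\<omega> \<in> space (M N). (X N \<omega>)\<^sup>2 \<le> u / (real N powr (1 / \<theta>) * ln (real N))})) \<le> 0"
proof -
  let ?h = "\<lambda>N. C * (l N / real N powr (\<delta> / \<theta>)) * u powr \<delta> * ln (real N) powr (- \<delta>) + C * u powr \<theta> * ln (real N) powr (- \<theta>)"
  have pw: "(\<lambda>N. ln (real N) powr (- a)) \<longlonglongrightarrow> 0" if "0 < a" for a
    using that by real_asymp
  have "?h \<longlonglongrightarrow> C * 0 * u powr \<delta> * 0 + C * u powr \<theta> * 0"
    using exponents by (intro tendsto_intros l_ratio_tendsto pw)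
  then have "(\<lambda>N. ereal (?h N)) \<longlonglongrightarrow> ereal 0" by simp
  then have lim: "limsup (\<lambda>N. ereal (?h N)) = 0"
    using lim_imp_Limsup[of sequentially "\<lambda>N. ereal (?h N)" "ereal 0"] by (simp add: zero_ereal_def)
  have "limsup (\<lambda>N. ereal (measure (M N) {\<omega> \<in> space (M N). (X N \<omega>)\<^sup>2 \<le> u / (real N powr (1 / \<theta>) * ln (real N))}))
      \<le> limsup (\<lambda>N. ereal (?h N))"
    by (intro Limsup_mono eventually_mono[OF eventually_ge_at_top[of 2]]) (use scaled_bound u in auto)
  then show ?thesis unfolding lim .
qed

text \<open>The variables are nonnegative, so tightness is a uniform bound on \<open>P (Y > b)\<close>. The index starts at
  2, where \<open>ln N \<ge> ln 2 > 0\<close> makes the bound of \<open>scaled_bound\<close> uniform in \<open>N\<close>.\<close>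

lemma tight_inverse_scaled:
  "tight (\<lambda>n. let N = n + 2 in distr (M N) borel (\<lambda>\<omega>. inverse (real N powr (1 / \<theta>) * ln (real N) * (X N \<omega>)\<^sup>2)))"
proof -
  let ?Y = "\<lambda>N \<omega>. inverse (real N powr (1 / \<theta>) * ln (real N) * (X N \<omega>)\<^sup>2)"
  have Ym: "?Y N \<in> borel_measurable (M N)" if "1 \<le> N" for N
    using meas[OF that] by measurable
  obtain S where S: "0 < S" "\<And>N. norm (l N / real N powr (\<delta> / \<theta>)) \<le> S"
    using convergent_imp_Bseq[OF convergentI[OF l_ratio_tendsto]] by (rule BseqE) (rule that, auto)
  let ?g = "\<lambda>b. C * S * ln 2 powr (- \<delta>) * (1 / b) powr \<delta> + C * ln 2 powr (- \<theta>) * (1 / b) powr \<theta>"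
  have pw: "((\<lambda>b. (1 / b) powr a) \<longlongrightarrow> 0) at_top" if "0 < a" for a :: real
    using that by real_asymp
  have "(?g \<longlongrightarrow> C * S * ln 2 powr (- \<delta>) * 0 + C * ln 2 powr (- \<theta>) * 0) at_top"
    using exponents by (intro tendsto_intros pw)
  then have g0: "(?g \<longlongrightarrow> 0) at_top" by simp
  have main: "1 - ?g b \<le> measure (distr (M N) borel (?Y N)) {-1<..b}" if N: "2 \<le> N" and b: "0 < b" for N b
  proof -
    interpret prob_space "M N" using prob_spaces N by simp
    let ?a = "real N powr (1 / \<theta>) * ln (real N)"
    have m[measurable]: "X N \<in> borel_measurable (M N)" using meas[of N] N by simp
    have Bm: "{\<omega> \<in> space (M N). (X N \<omega>)\<^sup>2 \<le> (1 / b) / ?a} \<in> sets (M N)" by measurable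
    have a: "0 < ?a" using N by simp
    have "1 - prob {\<omega> \<in> space (M N). (X N \<omega>)\<^sup>2 \<le> (1 / b) / ?a}
        = prob (space (M N) - {\<omega> \<in> space (M N). (X N \<omega>)\<^sup>2 \<le> (1 / b) / ?a})"
      using Bm by (rule prob_compl[symmetric])
    also have "\<dots> \<le> prob (?Y N -` {-1<..b} \<inter> space (M N))"
    proof (rule finite_measure_mono)
      show "space (M N) - {\<omega> \<in> space (M N). (X N \<omega>)\<^sup>2 \<le> (1 / b) / ?a} \<subseteq> ?Y N -` {-1<..b} \<inter> space (M N)"
      proof
        fix \<omega> assume "\<omega> \<in> space (M N) - {\<omega> \<in> space (M N). (X N \<omega>)\<^sup>2 \<le> (1 / b) / ?a}"
        then have \<omega>: "\<omega> \<in> space (M N)" and gt: "(1 / b) / ?a < (X N \<omega>)\<^sup>2" by auto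
        have "1 / b < ?a * (X N \<omega>)\<^sup>2" using gt a by (simp only: divide_less_eq if_True mult.commute)
        moreover have "0 < 1 / b" using b by simp
        ultimately have "inverse (?a * (X N \<omega>)\<^sup>2) < inverse (1 / b)" by (intro less_imp_inverse_less)
        then have "?Y N \<omega> \<le> b" using b by simp
        moreover have "0 \<le> ?Y N \<omega>"
          using a by (intro less_imp_le[OF a, THEN mult_nonneg_nonneg, THEN inverse_nonnegative_iff_nonnegative[THEN iffD2]]) simp
        ultimately show "\<omega> \<in> ?Y N -` {-1<..b} \<inter> space (M N)" using \<omega> by auto
      qed
      show "?Y N -` {-1<..b} \<inter> space (M N) \<in> sets (M N)"
        using Ym[of N] N by (intro measurable_sets[of _ _ borel]) auto
    qed
    also have "\<dots> = measure (distr (M N) borel (?Y N)) {-1<..b}"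
      using Ym[of N] N by (intro measure_distr[symmetric]) auto
    finally have "1 - measure (distr (M N) borel (?Y N)) {-1<..b} \<le> prob {\<omega> \<in> space (M N). (X N \<omega>)\<^sup>2 \<le> (1 / b) / ?a}"
      by linarith
    also have "\<dots> \<le> C * (l N / real N powr (\<delta> / \<theta>)) * (1 / b) powr \<delta> * ln (real N) powr (- \<delta>)
        + C * (1 / b) powr \<theta> * ln (real N) powr (- \<theta>)"
      using b by (intro scaled_bound N) simp
    also have "\<dots> \<le> C * S * (1 / b) powr \<delta> * ln 2 powr (- \<delta>) + C * (1 / b) powr \<theta> * ln 2 powr (- \<theta>)"
    proof -
      have "ln (real N) powr (- a) \<le> ln 2 powr (- a)" if "0 < a" for a
        using N that by (intro powr_mono2') auto
      moreover have "l N / real N powr (\<delta> / \<theta>) \<le> S"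
        using order_trans[OF abs_ge_self S(2)[unfolded real_norm_def]] .
      ultimately show ?thesis
        using C S exponents by (intro add_mono mult_mono mult_left_mono mult_right_mono) auto
    qed
    finally show ?thesis by (simp add: mult_ac)
  qed
  show ?thesis
    unfolding tight_def Let_def
  proof (intro conjI allI impI)
    fix n
    interpret prob_space "M (n + 2)" using prob_spaces by simp
    show "real_distribution (distr (M (n + 2)) borel (?Y (n + 2)))"
      by (rule real_distribution_distr) (rule Ym, simp)
  next
    fix \<epsilon> :: real assume "0 < \<epsilon>"
    then have "eventually (\<lambda>b. ?g b < \<epsilon>) at_top" using g0 by (auto dest: order_tendstoD(2))
    then have "eventually (\<lambda>b. ?g b < \<epsilon> \<and> 0 < b) at_top"
      using eventually_gt_at_top[of 0] by eventually_elim simp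
    then obtain b where b: "?g b < \<epsilon>" "0 < b" by (auto dest: eventually_happens simp: eventually_at_top_linorder)
    have "1 - \<epsilon> < measure (distr (M (n + 2)) borel (?Y (n + 2))) {-1<..b}" for n
      using main[of "n + 2" b] b by linarith
    then show "\<exists>a b. a < b \<and> (\<forall>n. 1 - \<epsilon> < measure (distr (M (n + 2)) borel (?Y (n + 2))) {a<..b})"
      using b(2) by (intro exI[of _ "-1"] exI[of _ b]) auto
  qed
qed

end

text \<open>The complement of the support is a union of open null sets, and by Lindelof's theorem countably many of them
  suffice.\<close>

lemma AE_in_measure_support:
  assumes "sets \<mu> = sets borel" shows "AE z in \<mu>. z \<in> measure_support \<mu>"
proof -
  let ?F = "{U :: complex set. open U \<and> emeasure \<mu> U = 0}"
  obtain F' where F': "F' \<subseteq> ?F" "countable F'" "\<Union>F' = \<Union>?F"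
    using Lindelof[of ?F] by auto
  have "\<Union>F' \<in> null_sets \<mu>"
    using F' assms by (intro null_sets_UN'[of F' "\<lambda>U. U", simplified]) (auto simp: null_sets_def)
  moreover have "{z \<in> space \<mu>. z \<notin> measure_support \<mu>} \<subseteq> \<Union>F'"
    unfolding F'(3) measure_support_def by (auto simp: not_gr_zero)
  ultimately show ?thesis by (rule AE_I')
qed

lemma measurable_perm_law_pair:
  assumes "\<And>\<sigma>. \<sigma> permutes {..<N} \<Longrightarrow> f \<sigma> \<in> measurable M K"
  shows "(\<lambda>(\<sigma>, d). f \<sigma> d) \<in> measurable (perm_law N \<Otimes>\<^sub>M M) K"
proof -
  have fin: "finite {\<sigma>. \<sigma> permutes {..<N}}" by (rule finite_permutations) simp
  have "(\<lambda>(\<sigma>, d). f \<sigma> d) \<in> measurable (count_space {\<sigma>. \<sigma> permutes {..<N}} \<Otimes>\<^sub>M M) K"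
    by (rule measurable_pair_measure_countable1) (use fin assms in \<open>auto intro: countable_finite\<close>)
  moreover have "sets (perm_law N \<Otimes>\<^sub>M M) = sets (count_space {\<sigma>. \<sigma> permutes {..<N}} \<Otimes>\<^sub>M M)"
    unfolding perm_law_def by (intro sets_pair_measure_cong sets_uniform_count_measure_count_space refl)
  ultimately show ?thesis using measurable_cong_sets by blast
qed

lemma prob_space_perm_law: "prob_space (perm_law N)"
  unfolding perm_law_def
  by (rule prob_space_uniform_count_measure) (auto intro: finite_permutations permutes_id)

lemma emeasure_perm_law_pair:
  assumes M: "prob_space M" and A: "A \<in> sets (perm_law N \<Otimes>\<^sub>M M)"
  shows "emeasure (perm_law N \<Otimes>\<^sub>M M) A
    = (\<Sum>\<sigma> | \<sigma> permutes {..<N}. ennreal (1 / fact N) * emeasure M (Pair \<sigma> -` A))"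
proof -
  interpret M: prob_space M by fact
  have fin: "finite {\<sigma>. \<sigma> permutes {..<N}}" by (rule finite_permutations) simp
  have card: "card {\<sigma>. \<sigma> permutes {..<N}} = fact N" by (rule card_permutations) auto
  show ?thesis
    unfolding M.emeasure_pair_measure_alt[OF A] unfolding perm_law_def uniform_count_measure_def card
    by (subst nn_integral_point_measure_finite[OF fin]) (auto simp: mult.commute)
qed


context diagonal_entries
begin

lemma small_ball_sequence_diag_law:
  assumes bound: "\<And>N \<sigma> t. 1 \<le> N \<Longrightarrow> \<sigma> permutes {..<N} \<Longrightarrow> 0 < t \<Longrightarrow>
      \<P>(d in diag_law \<mu> N. (s_min (diag_plus_perm N d \<sigma>))\<^sup>2 \<le> t)
        \<le> C * cycle_sum decay_rate N \<sigma> * t powr \<delta> + C * real N * t powr \<theta>"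
    and C: "0 \<le> C" and \<delta>: "0 < \<delta>" and \<sigma>: "\<And>N. \<sigma> N permutes {..<N}"
    and l: "(\<lambda>N. cycle_sum decay_rate N (\<sigma> N)) \<in> o(\<lambda>N. real N powr (\<delta> / \<theta>))"
  shows "small_ball_sequence (diag_law \<mu>) (\<lambda>N d. s_min (diag_plus_perm N d (\<sigma> N)))
    (\<lambda>N. cycle_sum decay_rate N (\<sigma> N)) C \<delta> \<theta>"
proof (rule small_ball_sequence.intro)
  fix N :: nat assume N: "1 \<le> N"
  show "prob_space (diag_law \<mu> N)" by (rule prob_space_diag_law)
  show "(\<lambda>d. s_min (diag_plus_perm N d (\<sigma> N))) \<in> borel_measurable (diag_law \<mu> N)"
    using N by (intro measurable_s_min_diag_law) simp
  show "0 \<le> s_min (diag_plus_perm N d (\<sigma> N))" for d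
    using N by (intro s_min_nonneg[OF diag_plus_perm_carrier]) simp
  show "\<P>(d in diag_law \<mu> N. (s_min (diag_plus_perm N d (\<sigma> N)))\<^sup>2 \<le> t)
      \<le> C * cycle_sum decay_rate N (\<sigma> N) * t powr \<delta> + C * real N * t powr \<theta>" if "0 < t" for t
    using N \<sigma> that by (rule bound)
qed (use C \<delta> theta l in auto)

text \<open>Averaging the bound over \<open>\<sigma>\<close> replaces \<open>L(k\<^sub>0, \<sigma>)\<close> by its mean, which is at most the mean
  number of cycles and hence at most \<open>ln N + 1\<close>.\<close>

lemma small_ball_sequence_perm_law:
  assumes bound: "\<And>N \<sigma> t. 1 \<le> N \<Longrightarrow> \<sigma> permutes {..<N} \<Longrightarrow> 0 < t \<Longrightarrow>
      \<P>(d in diag_law \<mu> N. (s_min (diag_plus_perm N d \<sigma>))\<^sup>2 \<le> t)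
        \<le> C * cycle_sum decay_rate N \<sigma> * t powr \<delta> + C * real N * t powr \<theta>"
    and C: "0 \<le> C" and \<delta>: "0 < \<delta>"
  shows "small_ball_sequence (\<lambda>N. perm_law N \<Otimes>\<^sub>M diag_law \<mu> N) (\<lambda>N (\<sigma>, d). s_min (diag_plus_perm N d \<sigma>))
    (\<lambda>N. ln (real N) + 1) C \<delta> \<theta>"
proof (rule small_ball_sequence.intro)
  fix N :: nat assume N: "1 \<le> N"
  let ?M = "perm_law N \<Otimes>\<^sub>M diag_law \<mu> N" and ?S = "{\<sigma>. \<sigma> permutes {..<N}}"
  show pM: "prob_space ?M"
    by (intro prob_space_pair prob_space_perm_law prob_space_diag_law)
  show meas: "(\<lambda>(\<sigma>, d). s_min (diag_plus_perm N d \<sigma>)) \<in> borel_measurable ?M"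
    using N by (intro measurable_perm_law_pair measurable_s_min_diag_law) simp
  show "0 \<le> (case \<omega> of (\<sigma>, d) \<Rightarrow> s_min (diag_plus_perm N d \<sigma>))" for \<omega>
    using N by (cases \<omega>) (auto intro: s_min_nonneg[OF diag_plus_perm_carrier])
  show "measure ?M {\<omega> \<in> space ?M. (case \<omega> of (\<sigma>, d) \<Rightarrow> s_min (diag_plus_perm N d \<sigma>))\<^sup>2 \<le> t}
      \<le> C * (ln (real N) + 1) * t powr \<delta> + C * real N * t powr \<theta>" if t: "0 < t" for t
  proof -
    let ?A = "{\<omega> \<in> space ?M. (case \<omega> of (\<sigma>, d) \<Rightarrow> s_min (diag_plus_perm N d \<sigma>))\<^sup>2 \<le> t}"
    let ?B = "\<lambda>\<sigma>. {d \<in> space (diag_law \<mu> N). (s_min (diag_plus_perm N d \<sigma>))\<^sup>2 \<le> t}"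
    let ?b = "\<lambda>\<sigma>. C * cycle_sum decay_rate N \<sigma> * t powr \<delta> + C * real N * t powr \<theta>"
    interpret M: prob_space ?M by (rule pM)
    interpret D: prob_space "diag_law \<mu> N" by (rule prob_space_diag_law)
    have A: "?A \<in> sets ?M" using meas by measurable
    have b0: "0 \<le> ?b \<sigma>" for \<sigma> using C cycle_sum_nonneg by simp
    have card: "card ?S = fact N" by (rule card_permutations) auto
    have slice: "Pair \<sigma> -` ?A = ?B \<sigma>" if "\<sigma> \<in> ?S" for \<sigma>
      using that by (auto simp: space_pair_measure perm_law_def space_uniform_count_measure)
    have "emeasure ?M ?A = (\<Sum>\<sigma>\<in>?S. ennreal (1 / fact N) * emeasure (diag_law \<mu> N) (?B \<sigma>))"
      unfolding emeasure_perm_law_pair[OF prob_space_diag_law A] using slice by (intro sum.cong refl) simp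
    also have "\<dots> \<le> (\<Sum>\<sigma>\<in>?S. ennreal (1 / fact N) * ennreal (?b \<sigma>))"
      unfolding D.emeasure_eq_measure using bound[OF N _ t]
      by (intro sum_mono mult_left_mono ennreal_leI) auto
    also have "\<dots> = (\<Sum>\<sigma>\<in>?S. ennreal (1 / fact N * ?b \<sigma>))"
      by (intro sum.cong refl ennreal_mult'[symmetric]) simp
    also have "\<dots> = ennreal (\<Sum>\<sigma>\<in>?S. 1 / fact N * ?b \<sigma>)"
      using b0 by (intro sum_ennreal mult_nonneg_nonneg) auto
    also have "(\<Sum>\<sigma>\<in>?S. 1 / fact N * ?b \<sigma>)
        = C * t powr \<delta> * ((\<Sum>\<sigma>\<in>?S. cycle_sum decay_rate N \<sigma>) / fact N) + C * real N * t powr \<theta>"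
    proof -
      have "(\<Sum>\<sigma>\<in>?S. 1 / fact N * ?b \<sigma>) = 1 / fact N * (\<Sum>\<sigma>\<in>?S. ?b \<sigma>)"
        by (rule sum_distrib_left[symmetric])
      also have "(\<Sum>\<sigma>\<in>?S. ?b \<sigma>)
          = C * (\<Sum>\<sigma>\<in>?S. cycle_sum decay_rate N \<sigma>) * t powr \<delta> + fact N * (C * real N * t powr \<theta>)"
        by (simp only: sum.distrib sum_distrib_left sum_distrib_right sum_constant card of_nat_fact)
      finally show ?thesis by (simp add: field_simps)
    qed
    also have "ennreal \<dots> \<le> ennreal (C * (ln (real N) + 1) * t powr \<delta> + C * real N * t powr \<theta>)"
    proof (rule ennreal_leI)
      have "(\<Sum>\<sigma>\<in>?S. cycle_sum decay_rate N \<sigma>) \<le> (\<Sum>\<sigma>\<in>?S. real (card (orbit \<sigma> ` {..<N})))"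
        using decay_rate_pos by (intro sum_mono cycle_sum_le_card) simp
      also have "\<dots> \<le> fact N * (\<Sum>k=1..N. 1 / real k)"
        using sum_card_orbits_le_harmonic[of "{..<N}"] by simp
      also have "(\<Sum>k=1..N. 1 / real k) = harm N"
        unfolding harm_def by (simp add: inverse_eq_divide)
      also have "fact N * (harm N :: real) \<le> fact N * (ln (real N) + 1)"
      proof -
        have "harm (Suc (N - 1)) - ln (real (Suc (N - 1))) \<le> harm (Suc 0) - ln (real (Suc 0))"
          using decseqD[OF decseq_harm_diff_ln, of 0 "N - 1"] by simp
        then have "harm N \<le> ln (real N) + (1 :: real)" using N by (simp add: harm_expand)
        then show ?thesis by (intro mult_left_mono) auto
      qed
      finally have "(\<Sum>\<sigma>\<in>?S. cycle_sum decay_rate N \<sigma>) / fact N \<le> ln (real N) + 1"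
        by (simp add: divide_le_eq mult.commute)
      then have "C * t powr \<delta> * ((\<Sum>\<sigma>\<in>?S. cycle_sum decay_rate N \<sigma>) / fact N) \<le> C * t powr \<delta> * (ln (real N) + 1)"
        using C by (intro mult_left_mono) auto
      then show "C * t powr \<delta> * ((\<Sum>\<sigma>\<in>?S. cycle_sum decay_rate N \<sigma>) / fact N) + C * real N * t powr \<theta>
          \<le> C * (ln (real N) + 1) * t powr \<delta> + C * real N * t powr \<theta>"
        by (simp only: mult_ac add_le_cancel_right)
    qed
    finally show ?thesis
      unfolding M.emeasure_eq_measure using C N by (subst (asm) ennreal_le_iff) (auto intro!: add_nonneg_nonneg mult_nonneg_nonneg)
  qed
next
  have "0 < \<delta> / \<theta>" using \<delta> theta by simp
  then show "(\<lambda>N. ln (real N) + 1) \<in> o(\<lambda>N. real N powr (\<delta> / \<theta>))" by real_asymp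
qed (use C \<delta> theta in auto)

end

lemma log_inv_powr_ge_1: "0 \<le> \<theta> \<Longrightarrow> 1 \<le> log_inv t powr \<theta>"
  unfolding log_inv_def by (intro ge_one_powr_ge_zero) auto

theorem theorem1p6:
  fixes \<mu> :: "complex measure" and \<theta> :: real
  assumes "prob_space \<mu>" and "sets \<mu> = sets borel"
    and H1: "\<exists>z\<in>measure_support \<mu>. norm z < 1" "\<exists>z\<in>measure_support \<mu>. norm z > 1"
      "\<exists>r>0. \<forall>z\<in>measure_support \<mu>. r \<le> norm z"
    and H2: "\<exists>t>1. integrable \<mu> (\<lambda>z. norm z powr t)"
    and H3: "(\<integral>z. ln (norm z) \<partial>\<mu>) < 0"
    and H4: "\<exists>C>0. \<exists>\<rho>. 0 < \<rho> \<and> \<rho> \<le> 1 \<and>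
      (\<forall>h>0. \<forall>x>0. measure \<mu> {z. x < norm z \<and> norm z < x + h} \<le> C * h powr \<rho>)"
    and "0 < \<theta>" and "(\<integral>z. norm z powr (2 * \<theta>) \<partial>\<mu>) = 1" and "\<theta> < 1"
  shows "\<exists>k0>0. \<exists>\<delta>0>0.
    (\<exists>C>0. \<forall>\<delta>. 0 < \<delta> \<and> \<delta> < \<delta>0 \<longrightarrow> (\<exists>C\<delta>>0. \<forall>N\<ge>1. \<forall>\<sigma>. \<sigma> permutes {..<N} \<longrightarrow> (\<forall>t>0.
       \<P>(d in diag_law \<mu> N. (s_min (diag_plus_perm N d \<sigma>))\<^sup>2 \<le> t)
         \<le> C\<delta> * cycle_sum k0 N \<sigma> * t powr \<delta> + C * real N * t powr \<theta> * log_inv t powr \<theta>)))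
    \<and>
    (\<forall>\<delta> \<alpha>. 0 < \<delta> \<and> \<delta> < \<delta>0 \<and> 0 < \<alpha> \<and> \<alpha> < min \<theta> \<delta> \<longrightarrow>
      (\<exists>C>0. \<forall>N\<ge>1. \<forall>\<sigma>. \<sigma> permutes {..<N} \<longrightarrow> (\<forall>t>0.
       \<P>(d in diag_law \<mu> N. (s_min (diag_plus_perm N d \<sigma>))\<^sup>2 \<le> t) \<le> C * real N * t powr \<alpha>)))
    \<and>
    (\<exists>C>0. \<forall>\<delta> \<sigma>. 0 < \<delta> \<and> \<delta> < \<delta>0 \<and> (\<forall>N. \<sigma> N permutes {..<N}) \<and>
        (\<lambda>N. cycle_sum k0 N (\<sigma> N)) \<in> o(\<lambda>N. real N powr (\<delta> / \<theta>)) \<longrightarrow>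
      (\<forall>N\<ge>1. AE d in diag_law \<mu> N. s_min (diag_plus_perm N d (\<sigma> N)) > 0) \<and>
      tight (\<lambda>n. let N = n + 2 in
        distr (diag_law \<mu> N) borel (\<lambda>d. inv_scaled_s_min \<theta> N (diag_plus_perm N d (\<sigma> N)))) \<and>
      (\<forall>u>0. limsup (\<lambda>N. ereal
         (\<P>(d in diag_law \<mu> N. (s_min (diag_plus_perm N d (\<sigma> N)))\<^sup>2
              \<le> u / (real N powr (1 / \<theta>) * ln (real N)))))
         \<le> ereal (C * u powr \<theta> * log_inv u powr \<theta>)))
    \<and>
    (\<exists>C>0.
      (\<forall>N\<ge>1. AE (\<sigma>, d) in perm_law N \<Otimes>\<^sub>M diag_law \<mu> N. s_min (diag_plus_perm N d \<sigma>) > 0) \<and>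
      tight (\<lambda>n. let N = n + 2 in
        distr (perm_law N \<Otimes>\<^sub>M diag_law \<mu> N) borel
          (\<lambda>(\<sigma>, d). inv_scaled_s_min \<theta> N (diag_plus_perm N d \<sigma>))) \<and>
      (\<forall>u>0. limsup (\<lambda>N. ereal
         (\<P>((\<sigma>, d) in perm_law N \<Otimes>\<^sub>M diag_law \<mu> N. (s_min (diag_plus_perm N d \<sigma>))\<^sup>2
              \<le> u / (real N powr (1 / \<theta>) * ln (real N)))))
         \<le> ereal (C * u powr \<theta> * log_inv u powr \<theta>)))"
proof -
  interpret p: prob_space \<mu> by fact
  obtain z0 r0 C0 \<rho> where z0: "z0 \<in> measure_support \<mu>" "norm z0 < 1"
    and r0: "0 < r0" "\<forall>z\<in>measure_support \<mu>. r0 \<le> norm z"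
    and C0: "0 < C0" "0 < \<rho>"
      "\<And>h x. 0 < h \<Longrightarrow> 0 < x \<Longrightarrow> measure \<mu> {z. x < norm z \<and> norm z < x + h} \<le> C0 * h powr \<rho>"
    using H1 H4 by meson
  \<comment> \<open>the lower bound on the modulus is taken below 1, so that its logarithm is negative\<close>
  interpret diagonal_entries \<mu> \<theta> "min r0 (1/2)" C0 \<rho>
  proof
    show "AE z in \<mu>. min r0 (1/2) \<le> norm z"
      using AE_in_measure_support[OF \<open>sets \<mu> = sets borel\<close>]
      by eventually_elim (use r0(2) in \<open>auto simp: min.coboundedI1\<close>)
    show "\<not> (AE z in \<mu>. norm z = 1)"
    proof
      assume "AE z in \<mu>. norm z = 1"
      then have "AE z in \<mu>. z \<notin> ball 0 1" by eventually_elim simp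
      then have "emeasure \<mu> (ball 0 1) = 0"
        using \<open>sets \<mu> = sets borel\<close> sets_eq_imp_space_eq[of \<mu> borel]
        by (subst (asm) AE_iff_measurable[of "ball 0 1"]) auto
      moreover have "0 < emeasure \<mu> (ball 0 1)"
        using z0 unfolding measure_support_def by auto
      ultimately show False by simp
    qed
  qed (use assms r0 C0 in auto)
  obtain \<delta>0 C where \<delta>0: "0 < \<delta>0" and C: "1 \<le> C"
    and bound_all: "\<forall>\<delta> N \<sigma> t. 0 < \<delta> \<and> \<delta> < \<delta>0 \<and> 1 \<le> N \<and> \<sigma> permutes {..<N} \<and> 0 < t \<longrightarrow>
      \<P>(d in diag_law \<mu> N. (s_min (diag_plus_perm N d \<sigma>))\<^sup>2 \<le> t)
        \<le> C * cycle_sum decay_rate N \<sigma> * t powr \<delta> + C * real N * t powr \<theta>"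
    using prob_s_min_le by (elim exE conjE)
  have bound: "\<P>(d in diag_law \<mu> N. (s_min (diag_plus_perm N d \<sigma>))\<^sup>2 \<le> t)
        \<le> C * cycle_sum decay_rate N \<sigma> * t powr \<delta> + C * real N * t powr \<theta>"
    if "0 < \<delta>" "\<delta> < \<delta>0" "1 \<le> N" "\<sigma> permutes {..<N}" "0 < t" for \<delta> N \<sigma> t
    by (rule bound_all[rule_format]) (use that in blast)
  have part1: "\<P>(d in diag_law \<mu> N. (s_min (diag_plus_perm N d \<sigma>))\<^sup>2 \<le> t)
      \<le> C * cycle_sum decay_rate N \<sigma> * t powr \<delta> + C * real N * t powr \<theta> * log_inv t powr \<theta>"
    if "0 < \<delta>" "\<delta> < \<delta>0" "1 \<le> N" "\<sigma> permutes {..<N}" "0 < t" for \<delta> N \<sigma> t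
  proof -
    have "C * real N * t powr \<theta> * 1 \<le> C * real N * t powr \<theta> * log_inv t powr \<theta>"
      using C theta log_inv_powr_ge_1[of \<theta> t] by (intro mult_left_mono) auto
    then show ?thesis using bound[OF that] by linarith
  qed
  have part2: "\<P>(d in diag_law \<mu> N. (s_min (diag_plus_perm N d \<sigma>))\<^sup>2 \<le> t) \<le> 2 * C * real N * t powr \<alpha>"
    if \<delta>: "0 < \<delta>" "\<delta> < \<delta>0" and \<alpha>: "0 < \<alpha>" "\<alpha> < min \<theta> \<delta>"
      and N: "1 \<le> N" and \<sigma>: "\<sigma> permutes {..<N}" and t: "0 < t" for \<delta> \<alpha> N \<sigma> t
  proof (cases "t \<le> 1")
    case True
    have "cycle_sum decay_rate N \<sigma> \<le> real (card (orbit \<sigma> ` {..<N}))"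
      using decay_rate_pos by (intro cycle_sum_le_card) simp
    also have "\<dots> \<le> real N" using card_image_le[of "{..<N}" "orbit \<sigma>"] by simp
    finally have L: "cycle_sum decay_rate N \<sigma> \<le> real N" .
    have pw: "t powr \<delta> \<le> t powr \<alpha>" "t powr \<theta> \<le> t powr \<alpha>"
      using t True \<alpha> by (auto intro!: powr_mono')
    have "C * cycle_sum decay_rate N \<sigma> * t powr \<delta> \<le> C * real N * t powr \<alpha>"
      using L pw C cycle_sum_nonneg by (intro mult_mono) auto
    moreover have "C * real N * t powr \<theta> \<le> C * real N * t powr \<alpha>"
      using pw C by (intro mult_left_mono) auto
    ultimately show ?thesis using bound[OF \<delta> N \<sigma> t] by linarith
  next
    case False
    interpret D: prob_space "diag_law \<mu> N" by (rule prob_space_diag_law)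
    have "1 * 1 * 1 \<le> 2 * C * real N * t powr \<alpha>"
      using C N False \<alpha> by (intro mult_mono ge_one_powr_ge_zero) auto
    then show ?thesis using D.prob_le_1 by (smt (verit, best))
  qed
  have nonneg: "0 \<le> ereal (1 * u powr \<theta> * log_inv u powr \<theta>)" for u by simp
  have half: "0 < \<delta>0 / 2" "\<delta>0 / 2 < \<delta>0" using \<delta>0 by auto
  interpret S: small_ball_sequence "\<lambda>N. perm_law N \<Otimes>\<^sub>M diag_law \<mu> N"
      "\<lambda>N (\<sigma>, d). s_min (diag_plus_perm N d \<sigma>)" "\<lambda>N. ln (real N) + 1" C "\<delta>0 / 2" \<theta>
    by (rule small_ball_sequence_perm_law[OF bound[OF half]]) (use C half in auto)
  show ?thesis
  proof (rule exI[of _ decay_rate], intro conjI decay_rate_pos, rule exI[of _ \<delta>0], intro conjI \<delta>0,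
      goal_cases)
    case 1
    show ?case
      using part1 C by (intro exI[of _ C] conjI allI impI) auto
  next
    case 2
    show ?case
      using part2 C by (intro allI impI exI[of _ "2 * C"] conjI) auto
  next
    case 3
    show ?case
    proof (rule exI[of _ "1 :: real"], rule conjI, simp, intro allI impI, elim conjE)
      fix \<delta> \<sigma>
      assume \<delta>: "0 < \<delta>" "\<delta> < \<delta>0" and \<sigma>: "\<forall>N. \<sigma> N permutes {..<N}"
        and l: "(\<lambda>N. cycle_sum decay_rate N (\<sigma> N)) \<in> o(\<lambda>N. real N powr (\<delta> / \<theta>))"
      interpret T: small_ball_sequence "diag_law \<mu>" "\<lambda>N d. s_min (diag_plus_perm N d (\<sigma> N))"
          "\<lambda>N. cycle_sum decay_rate N (\<sigma> N)" C \<delta> \<theta>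
        by (rule small_ball_sequence_diag_law[OF bound[OF \<delta>]]) (use C \<delta> \<sigma> l in auto)
      show "(\<forall>N\<ge>1. AE d in diag_law \<mu> N. 0 < s_min (diag_plus_perm N d (\<sigma> N))) \<and>
        tight (\<lambda>n. let N = n + 2 in
          distr (diag_law \<mu> N) borel (\<lambda>d. inv_scaled_s_min \<theta> N (diag_plus_perm N d (\<sigma> N)))) \<and>
        (\<forall>u>0. limsup (\<lambda>N. ereal (\<P>(d in diag_law \<mu> N. (s_min (diag_plus_perm N d (\<sigma> N)))\<^sup>2
              \<le> u / (real N powr (1 / \<theta>) * ln (real N)))))
           \<le> ereal (1 * u powr \<theta> * log_inv u powr \<theta>))"
        unfolding inv_scaled_s_min_def
        using T.AE_pos T.tight_inverse_scaled order_trans[OF T.limsup_scaled nonneg] by blast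
    qed
  next
    case 4
    show ?case
      unfolding inv_scaled_s_min_def
    proof (rule exI[of _ "1 :: real"], rule conjI, simp, intro conjI allI impI)
      show "AE (\<sigma>, d) in perm_law N \<Otimes>\<^sub>M diag_law \<mu> N. 0 < s_min (diag_plus_perm N d \<sigma>)" if "1 \<le> N" for N
        using S.AE_pos[OF that] by (simp add: split_def)
      show "tight (\<lambda>n. let N = n + 2 in distr (perm_law N \<Otimes>\<^sub>M diag_law \<mu> N) borel
          (\<lambda>(\<sigma>, d). inverse (real N powr (1 / \<theta>) * ln (real N) * (s_min (diag_plus_perm N d \<sigma>))\<^sup>2)))"
        using S.tight_inverse_scaled by (simp only: split_def)
      show "limsup (\<lambda>N. ereal (\<P>((\<sigma>, d) in perm_law N \<Otimes>\<^sub>M diag_law \<mu> N. (s_min (diag_plus_perm N d \<sigma>))\<^sup>2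
              \<le> u / (real N powr (1 / \<theta>) * ln (real N)))))
           \<le> ereal (1 * u powr \<theta> * log_inv u powr \<theta>)" if "0 < u" for u
        using order_trans[OF S.limsup_scaled[OF that] nonneg[of u]]
        by (simp only: split_def prod.collapse)
    qed
  qed
qed

end
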